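(* Let $\theta\in(0,1)$ be an irrational number, and let $R$ be the hyperfinite type $\mathrm{II}_1$ factor generated by two unitaries $u,v$ with $vu=e^{2\pi i\theta}uv$. Then $u+v$ is strongly irreducible relative to $R$, i.e., there is no nontrivial idempotent in $\{u+v\}'\cap R$.
   Context: $R$ is the strong operator closure of the irrational rotation algebra $A_\theta=C^*(u,v)$ (the universal $C^*$-algebra generated by unitaries $u,v$ with $vu=e^{2\pi i\theta}uv$) acting on $L^2(A_\theta,\tau)$ by the GNS construction of its unique tracial state $\tau$. $\{T\}'$ denotes the commutant of $T$ (operators commuting with $T$). An idempotent is an element $e$ (not necessarily self-adjoint) with $e^2=e$; it is nontrivial if $e\neq 0,1$. *)

theory Defs
  imports "HOL-Analysis.Analysis"
begin

class complex_normed_vector = real_normed_vector +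
  fixes scaleC :: "complex \<Rightarrow> 'a \<Rightarrow> 'a" (infixr "*\<^sub>C" 75)
  assumes scaleC_of_real: "complex_of_real r *\<^sub>C x = r *\<^sub>R x"
    and scaleC_add_right: "c *\<^sub>C (x + y) = c *\<^sub>C x + c *\<^sub>C y"
    and scaleC_add_left: "(c + d) *\<^sub>C x = c *\<^sub>C x + d *\<^sub>C x"
    and scaleC_scaleC: "c *\<^sub>C d *\<^sub>C x = (c * d) *\<^sub>C x"
    and norm_scaleC: "norm (c *\<^sub>C x) = cmod c * norm x"

text \<open>The inner product is linear in the first argument. Positive definiteness is
  contained in \<open>cinner_self\<close>.\<close>

class complex_hilbert_space = complex_normed_vector + complete_space +
  fixes cinner :: "'a \<Rightarrow> 'a \<Rightarrow> complex"
  assumes cinner_commute: "cinner x y = cnj (cinner y x)"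
    and cinner_add_left: "cinner (x + y) z = cinner x z + cinner y z"
    and cinner_scaleC_left: "cinner (c *\<^sub>C x) y = c * cinner x y"
    and cinner_self: "cinner x x = complex_of_real ((norm x)\<^sup>2)"

text \<open>Submultiplicativity of the norm and \<open>norm 1 = 1\<close> come from \<open>real_normed_algebra_1\<close>.\<close>

class cstar_algebra = complex_normed_vector + real_normed_algebra_1 + complete_space +
  fixes star :: "'a \<Rightarrow> 'a"
  assumes scaleC_mult_left: "(c *\<^sub>C a) * b = c *\<^sub>C (a * b)"
    and scaleC_mult_right: "a * (c *\<^sub>C b) = c *\<^sub>C (a * b)"
    and star_star: "star (star a) = a"
    and star_add: "star (a + b) = star a + star b"
    and star_scaleC: "star (c *\<^sub>C a) = cnj c *\<^sub>C star a"
    and star_mult: "star (a * b) = star b * star a"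
    and cstar_identity: "norm (star a * a) = (norm a)\<^sup>2"

typedef ell2 = "{f :: nat \<Rightarrow> complex. summable (\<lambda>n. (cmod (f n))\<^sup>2)}"
  morphisms ell2_nth Abs_ell2
  by (rule exI[of _ "\<lambda>_. 0"]) simp

lemma ell2_summable: "summable (\<lambda>n. (cmod (ell2_nth x n))\<^sup>2)"
  using ell2_nth[of x] by simp

lemma ell2_nth_Abs: "summable (\<lambda>n. (cmod (f n))\<^sup>2) \<Longrightarrow> ell2_nth (Abs_ell2 f) = f"
  by (simp add: Abs_ell2_inverse)

lemma ell2_eqI: "(\<And>n. ell2_nth x n = ell2_nth y n) \<Longrightarrow> x = y"
  by (rule ell2_nth_inject[THEN iffD1]) (rule ext)

lemma square_summable_add:
  fixes f g :: "nat \<Rightarrow> complex"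
  assumes "summable (\<lambda>n. (cmod (f n))\<^sup>2)" "summable (\<lambda>n. (cmod (g n))\<^sup>2)"
  shows "summable (\<lambda>n. (cmod (f n + g n))\<^sup>2)"
proof (rule summable_comparison_test')
  show "summable (\<lambda>n. 2 * (cmod (f n))\<^sup>2 + 2 * (cmod (g n))\<^sup>2)"
    using assms by (intro summable_add summable_mult)
  fix n :: nat
  have "(cmod (f n + g n))\<^sup>2 \<le> (cmod (f n) + cmod (g n))\<^sup>2"
    by (simp add: norm_triangle_ineq power_mono)
  also have "\<dots> \<le> 2 * (cmod (f n))\<^sup>2 + 2 * (cmod (g n))\<^sup>2"
    using sum_squares_bound[of "cmod (f n)" "cmod (g n)"] by (simp add: power2_sum)
  finally show "norm ((cmod (f n + g n))\<^sup>2) \<le> 2 * (cmod (f n))\<^sup>2 + 2 * (cmod (g n))\<^sup>2"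
    by simp
qed

lemma square_summable_scale:
  fixes f :: "nat \<Rightarrow> complex"
  assumes "summable (\<lambda>n. (cmod (f n))\<^sup>2)"
  shows "summable (\<lambda>n. (cmod (c * f n))\<^sup>2)"
  using summable_mult[OF assms, of "(cmod c)\<^sup>2"] by (simp add: norm_mult power_mult_distrib)

instantiation ell2 :: complex_normed_vector
begin

definition zero_ell2 :: ell2 where "0 = Abs_ell2 (\<lambda>_. 0)"
definition plus_ell2 :: "ell2 \<Rightarrow> ell2 \<Rightarrow> ell2"
  where "x + y = Abs_ell2 (\<lambda>n. ell2_nth x n + ell2_nth y n)"
definition scaleC_ell2 :: "complex \<Rightarrow> ell2 \<Rightarrow> ell2"
  where "c *\<^sub>C x = Abs_ell2 (\<lambda>n. c * ell2_nth x n)"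
definition scaleR_ell2 :: "real \<Rightarrow> ell2 \<Rightarrow> ell2"
  where "r *\<^sub>R (x :: ell2) = complex_of_real r *\<^sub>C x"
definition uminus_ell2 :: "ell2 \<Rightarrow> ell2" where "- x = (- 1) *\<^sub>C (x :: ell2)"
definition minus_ell2 :: "ell2 \<Rightarrow> ell2 \<Rightarrow> ell2" where "x - y = x + - (y :: ell2)"
definition norm_ell2 :: "ell2 \<Rightarrow> real"
  where "norm x = sqrt (\<Sum>n. (cmod (ell2_nth x n))\<^sup>2)"
definition dist_ell2 :: "ell2 \<Rightarrow> ell2 \<Rightarrow> real" where "dist x y = norm (x - y :: ell2)"
definition sgn_ell2 :: "ell2 \<Rightarrow> ell2" where "sgn x = inverse (norm x) *\<^sub>R (x :: ell2)"
definition uniformity_ell2 :: "(ell2 \<times> ell2) filter"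
  where "uniformity = (INF e\<in>{0<..}. principal {(x :: ell2, y). dist x y < e})"
definition open_ell2 :: "ell2 set \<Rightarrow> bool"
  where "open U = (\<forall>x\<in>U. eventually (\<lambda>(x', y). x' = x \<longrightarrow> y \<in> (U :: ell2 set)) uniformity)"

lemma ell2_nth_zero: "ell2_nth 0 n = 0"
  by (simp add: zero_ell2_def ell2_nth_Abs)

lemma ell2_nth_add: "ell2_nth (x + y) n = ell2_nth x n + ell2_nth y n"
  by (simp add: plus_ell2_def ell2_nth_Abs square_summable_add ell2_summable)

lemma ell2_nth_scaleC: "ell2_nth (c *\<^sub>C x) n = c * ell2_nth x n"
  by (simp add: scaleC_ell2_def ell2_nth_Abs square_summable_scale ell2_summable)

lemma ell2_nth_scaleR: "ell2_nth (r *\<^sub>R x) n = complex_of_real r * ell2_nth x n"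
  by (simp add: scaleR_ell2_def ell2_nth_scaleC)

lemma ell2_nth_uminus: "ell2_nth (- x) n = - ell2_nth x n"
  by (simp add: uminus_ell2_def ell2_nth_scaleC)

lemma ell2_nth_minus: "ell2_nth (x - y) n = ell2_nth x n - ell2_nth y n"
  by (simp add: minus_ell2_def ell2_nth_add ell2_nth_uminus)

lemmas ell2_nth_simps =
  ell2_nth_zero ell2_nth_add ell2_nth_scaleC ell2_nth_scaleR ell2_nth_uminus ell2_nth_minus

lemma ell2_norm_square: "(norm x)\<^sup>2 = (\<Sum>n. (cmod (ell2_nth x n))\<^sup>2)"
  by (simp add: norm_ell2_def ell2_summable suminf_nonneg)

lemma ell2_partial_norm_tendsto:
  "(\<lambda>N. L2_set (\<lambda>n. cmod (ell2_nth x n)) {..<N}) \<longlonglongrightarrow> norm x"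
  unfolding L2_set_def norm_ell2_def
  by (intro tendsto_real_sqrt summable_LIMSEQ ell2_summable)

lemma ell2_partial_norm_le: "L2_set (\<lambda>n. cmod (ell2_nth x n)) {..<N} \<le> norm x"
  unfolding L2_set_def norm_ell2_def
  by (intro real_sqrt_le_mono sum_le_suminf ell2_summable) auto

lemma ell2_nth_le_norm: "cmod (ell2_nth x n) \<le> norm x"
proof -
  have "cmod (ell2_nth x n) \<le> L2_set (\<lambda>n. cmod (ell2_nth x n)) {..<Suc n}"
    by (rule member_le_L2_set) auto
  also have "\<dots> \<le> norm x" by (rule ell2_partial_norm_le)
  finally show ?thesis .
qed

lemma ell2_norm_triangle: "norm (x + y :: ell2) \<le> norm x + norm y"
proof (rule LIMSEQ_le_const2[OF ell2_partial_norm_tendsto], intro exI allI impI)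
  fix N :: nat
  have "L2_set (\<lambda>n. cmod (ell2_nth (x + y) n)) {..<N}
      \<le> L2_set (\<lambda>n. cmod (ell2_nth x n) + cmod (ell2_nth y n)) {..<N}"
    by (intro L2_set_mono) (auto simp: ell2_nth_add norm_triangle_ineq)
  also have "\<dots> \<le> L2_set (\<lambda>n. cmod (ell2_nth x n)) {..<N} + L2_set (\<lambda>n. cmod (ell2_nth y n)) {..<N}"
    by (rule L2_set_triangle_ineq)
  also have "\<dots> \<le> norm x + norm y"
    by (intro add_mono ell2_partial_norm_le)
  finally show "L2_set (\<lambda>n. cmod (ell2_nth (x + y) n)) {..<N} \<le> norm x + norm y" .
qed

lemma ell2_norm_scaleC: "norm (c *\<^sub>C x :: ell2) = cmod c * norm x"
  by (simp add: norm_ell2_def ell2_nth_scaleC norm_mult power_mult_distrib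
      suminf_mult ell2_summable real_sqrt_mult)

lemma ell2_norm_eq_0: "norm (x :: ell2) = 0 \<longleftrightarrow> x = 0"
proof
  assume "norm x = 0"
  then have "ell2_nth x n = 0" for n
    using ell2_nth_le_norm[of x n] by simp
  then show "x = 0" by (intro ell2_eqI) (simp add: ell2_nth_zero)
qed (simp add: norm_ell2_def ell2_nth_zero)

instance
proof
  fix x y z :: ell2 and a b :: real and c d :: complex
  show "x + y + z = x + (y + z)" "x + y = y + x" "0 + x = x" "- x + x = 0" "x - y = x + - y"
    "a *\<^sub>R (x + y) = a *\<^sub>R x + a *\<^sub>R y" "(a + b) *\<^sub>R x = a *\<^sub>R x + b *\<^sub>R x"
    "a *\<^sub>R b *\<^sub>R x = (a * b) *\<^sub>R x" "1 *\<^sub>R x = x"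
    "complex_of_real a *\<^sub>C x = a *\<^sub>R x"
    "c *\<^sub>C (x + y) = c *\<^sub>C x + c *\<^sub>C y" "(c + d) *\<^sub>C x = c *\<^sub>C x + d *\<^sub>C x"
    "c *\<^sub>C d *\<^sub>C x = (c * d) *\<^sub>C x"
    by (auto intro!: ell2_eqI simp: ell2_nth_simps algebra_simps)
  show "dist x y = norm (x - y)" by (rule dist_ell2_def)
  show "sgn x = inverse (norm x) *\<^sub>R x" by (rule sgn_ell2_def)
  show "uniformity = (INF e\<in>{0<..}. principal {(x :: ell2, y). dist x y < e})"
    by (rule uniformity_ell2_def)
  show "open U = (\<forall>x\<in>U. \<forall>\<^sub>F (x', y) in uniformity. x' = x \<longrightarrow> y \<in> U)" for U :: "ell2 set"
    by (rule open_ell2_def)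
  show "norm x = 0 \<longleftrightarrow> x = 0" by (rule ell2_norm_eq_0)
  show "norm (x + y) \<le> norm x + norm y" by (rule ell2_norm_triangle)
  show "norm (a *\<^sub>R x) = \<bar>a\<bar> * norm x" by (simp add: scaleR_ell2_def ell2_norm_scaleC)
  show "norm (c *\<^sub>C x) = cmod c * norm x" by (rule ell2_norm_scaleC)
qed

end

lemma ell2_cinner_summable: "summable (\<lambda>n. ell2_nth x n * cnj (ell2_nth y n))"
proof (rule summable_norm_cancel, rule summable_comparison_test')
  show "summable (\<lambda>n. (cmod (ell2_nth x n))\<^sup>2 + (cmod (ell2_nth y n))\<^sup>2)"
    by (intro summable_add ell2_summable)
  fix n :: nat
  have "2 * (cmod (ell2_nth x n) * cmod (ell2_nth y n))
      \<le> (cmod (ell2_nth x n))\<^sup>2 + (cmod (ell2_nth y n))\<^sup>2"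
    using sum_squares_bound[of "cmod (ell2_nth x n)" "cmod (ell2_nth y n)"] by simp
  moreover have "0 \<le> cmod (ell2_nth x n) * cmod (ell2_nth y n)" by simp
  ultimately show "norm (norm (ell2_nth x n * cnj (ell2_nth y n)))
      \<le> (cmod (ell2_nth x n))\<^sup>2 + (cmod (ell2_nth y n))\<^sup>2"
    unfolding real_norm_def norm_mult complex_mod_cnj by linarith
qed

lemma ell2_complete:
  fixes X :: "nat \<Rightarrow> ell2"
  assumes cauchy: "\<And>e. 0 < e \<Longrightarrow> \<exists>M. \<forall>m\<ge>M. \<forall>k\<ge>M. norm (X m - X k) < e"
  shows "\<exists>L. \<forall>e>0. \<exists>M. \<forall>m\<ge>M. norm (X m - L) < e"
proof -
  have "Cauchy (\<lambda>m. ell2_nth (X m) n)" for n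
  proof (rule CauchyI)
    fix e :: real assume "0 < e"
    then obtain M where "\<forall>m\<ge>M. \<forall>k\<ge>M. norm (X m - X k) < e" using cauchy by blast
    moreover have "norm (ell2_nth (X m) n - ell2_nth (X k) n) \<le> norm (X m - X k)" for m k
      using ell2_nth_le_norm[of "X m - X k" n] by (simp add: ell2_nth_minus)
    ultimately have "\<forall>m\<ge>M. \<forall>k\<ge>M. norm (ell2_nth (X m) n - ell2_nth (X k) n) < e"
      by (meson order.strict_trans1)
    then show "\<exists>M. \<forall>m\<ge>M. \<forall>k\<ge>M. norm (ell2_nth (X m) n - ell2_nth (X k) n) < e" ..
  qed
  then have conv: "convergent (\<lambda>m. ell2_nth (X m) n)" for n
    by (simp only: Cauchy_convergent_iff)
  define f where "f n = lim (\<lambda>m. ell2_nth (X m) n)" for n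
  have f: "(\<lambda>m. ell2_nth (X m) n) \<longlonglongrightarrow> f n" for n
    using conv[of n] by (simp only: f_def convergent_LIMSEQ_iff)
  have partial: "L2_set (\<lambda>n. cmod (ell2_nth (X m) n - f n)) {..<N} \<le> e"
    if M: "\<forall>m\<ge>M. \<forall>k\<ge>M. norm (X m - X k) < e" and m: "m \<ge> M" for e M m N
  proof (rule LIMSEQ_le_const2)
    show "(\<lambda>k. L2_set (\<lambda>n. cmod (ell2_nth (X m) n - ell2_nth (X k) n)) {..<N})
        \<longlonglongrightarrow> L2_set (\<lambda>n. cmod (ell2_nth (X m) n - f n)) {..<N}"
      unfolding L2_set_def by (intro tendsto_intros f)
    have "L2_set (\<lambda>n. cmod (ell2_nth (X m) n - ell2_nth (X k) n)) {..<N} \<le> e" if "k \<ge> M" for k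
    proof -
      have "L2_set (\<lambda>n. cmod (ell2_nth (X m) n - ell2_nth (X k) n)) {..<N} \<le> norm (X m - X k)"
        using ell2_partial_norm_le[of "X m - X k" N] by (simp add: ell2_nth_minus)
      also have "\<dots> < e" using M m that by blast
      finally show ?thesis by simp
    qed
    then show "\<exists>K. \<forall>k\<ge>K. L2_set (\<lambda>n. cmod (ell2_nth (X m) n - ell2_nth (X k) n)) {..<N} \<le> e"
      by blast
  qed
  have diff_summable: "summable (\<lambda>n. (cmod (ell2_nth (X m) n - f n))\<^sup>2)"
    if M: "\<forall>m\<ge>M. \<forall>k\<ge>M. norm (X m - X k) < e" and m: "m \<ge> M" for e M m
  proof (rule summableI_nonneg_bounded)
    fix N
    show "(\<Sum>n<N. (cmod (ell2_nth (X m) n - f n))\<^sup>2) \<le> e\<^sup>2"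
      using partial[OF M m, of N] unfolding L2_set_def by (rule sqrt_le_D)
  qed simp
  obtain M1 where M1: "\<forall>m\<ge>M1. \<forall>k\<ge>M1. norm (X m - X k) < 1"
    using cauchy[OF zero_less_one] ..
  have "summable (\<lambda>n. (cmod (ell2_nth (X M1) n + (- 1) * (ell2_nth (X M1) n - f n)))\<^sup>2)"
    by (intro square_summable_add square_summable_scale ell2_summable diff_summable[OF M1]) simp
  then have "summable (\<lambda>n. (cmod (f n))\<^sup>2)" by simp
  then have L: "ell2_nth (Abs_ell2 f) = f" by (rule ell2_nth_Abs)
  have "\<exists>M. \<forall>m\<ge>M. norm (X m - Abs_ell2 f) < e" if "0 < e" for e
  proof -
    have "0 < e / 2" using \<open>0 < e\<close> by simp
    from cauchy[OF this] obtain M where M: "\<forall>m\<ge>M. \<forall>k\<ge>M. norm (X m - X k) < e / 2" ..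
    have "norm (X m - Abs_ell2 f) \<le> e / 2" if "m \<ge> M" for m
    proof (rule LIMSEQ_le_const2[OF ell2_partial_norm_tendsto], intro exI allI impI)
      show "L2_set (\<lambda>n. cmod (ell2_nth (X m - Abs_ell2 f) n)) {..<N} \<le> e / 2" for N
        unfolding ell2_nth_minus L by (rule partial[OF M that])
    qed
    then have "norm (X m - Abs_ell2 f) < e" if "m \<ge> M" for m
      using that \<open>0 < e\<close> by force
    then show ?thesis by blast
  qed
  then show ?thesis by blast
qed

instantiation ell2 :: complex_hilbert_space
begin

definition cinner_ell2 :: "ell2 \<Rightarrow> ell2 \<Rightarrow> complex"
  where "cinner x y = (\<Sum>n. ell2_nth x n * cnj (ell2_nth y n))"

instance
proof
  fix x y z :: ell2 and c :: complex
  show "cinner x y = cnj (cinner y x)"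
  proof -
    have "(\<lambda>n. cnj (ell2_nth y n * cnj (ell2_nth x n))) sums cnj (cinner y x)"
      unfolding cinner_ell2_def sums_cnj by (rule summable_sums[OF ell2_cinner_summable])
    then show ?thesis unfolding cinner_ell2_def[of x y] by (simp add: sums_iff mult.commute)
  qed
  show "cinner (x + y) z = cinner x z + cinner y z"
    by (simp add: cinner_ell2_def ell2_nth_add distrib_right suminf_add ell2_cinner_summable)
  show "cinner (c *\<^sub>C x) y = c * cinner x y"
    by (simp add: cinner_ell2_def ell2_nth_scaleC mult.assoc suminf_mult ell2_cinner_summable)
  show "cinner x x = complex_of_real ((norm x)\<^sup>2)"
    unfolding cinner_ell2_def ell2_norm_square
    by (subst suminf_of_real[OF ell2_summable]) (simp only: complex_norm_square)
next
  fix X :: "nat \<Rightarrow> ell2"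
  assume "Cauchy X"
  then have "\<exists>L. \<forall>e>0. \<exists>M. \<forall>m\<ge>M. norm (X m - L) < e"
    by (intro ell2_complete) (auto simp: Cauchy_def dist_norm)
  then show "convergent X" by (auto simp: convergent_def LIMSEQ_iff)
qed

end

text \<open>The library's \<open>'h \<Rightarrow>\<^sub>L 'h\<close> consists of the bounded \<^emph>\<open>real\<close>-linear operators; \<open>B(H)\<close> is
  the set of complex-linear ones.\<close>

definition bounded_operators :: "('h :: complex_hilbert_space \<Rightarrow>\<^sub>L 'h) set"
  where "bounded_operators = {T. \<forall>c x. blinfun_apply T (c *\<^sub>C x) = c *\<^sub>C blinfun_apply T x}"

definition is_adjoint ::
    "('h :: complex_hilbert_space \<Rightarrow>\<^sub>L 'h) \<Rightarrow> ('h \<Rightarrow>\<^sub>L 'h) \<Rightarrow> bool"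
  where "is_adjoint S T \<longleftrightarrow>
    (\<forall>x y. cinner (blinfun_apply T x) y = cinner x (blinfun_apply S y))"

definition unitary_operator :: "('h :: complex_hilbert_space \<Rightarrow>\<^sub>L 'h) \<Rightarrow> bool"
  where "unitary_operator U \<longleftrightarrow> U \<in> bounded_operators \<and>
    (\<exists>W\<in>bounded_operators. is_adjoint W U \<and> U o\<^sub>L W = id_blinfun \<and> W o\<^sub>L U = id_blinfun)"

definition sot_closure ::
    "('h :: complex_hilbert_space \<Rightarrow>\<^sub>L 'h) set \<Rightarrow> ('h \<Rightarrow>\<^sub>L 'h) set"
  where "sot_closure S = subtopology strong_operator_topology bounded_operators closure_of S"

definition commutant :: "('h :: complex_hilbert_space \<Rightarrow>\<^sub>L 'h) set \<Rightarrow> ('h \<Rightarrow>\<^sub>L 'h) set"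
  where "commutant S = {T \<in> bounded_operators. \<forall>A\<in>S. T o\<^sub>L A = A o\<^sub>L T}"

definition strongly_irreducible_relative ::
    "('h :: complex_hilbert_space \<Rightarrow>\<^sub>L 'h) \<Rightarrow> ('h \<Rightarrow>\<^sub>L 'h) set \<Rightarrow> bool"
  where "strongly_irreducible_relative T R \<longleftrightarrow>
    \<not> (\<exists>e \<in> commutant {T} \<inter> R. e o\<^sub>L e = e \<and> e \<noteq> 0 \<and> e \<noteq> id_blinfun)"

definition unitary_element :: "'a :: cstar_algebra \<Rightarrow> bool"
  where "unitary_element u \<longleftrightarrow> star u * u = 1 \<and> u * star u = 1"

definition cstar_subalgebra :: "'a :: cstar_algebra set \<Rightarrow> bool"
  where "cstar_subalgebra B \<longleftrightarrow> closed B \<and> 1 \<in> B \<and>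
    (\<forall>a\<in>B. \<forall>b\<in>B. a + b \<in> B \<and> a * b \<in> B) \<and>
    (\<forall>a\<in>B. star a \<in> B \<and> (\<forall>c. c *\<^sub>C a \<in> B))"

definition generated_cstar_subalgebra :: "'a :: cstar_algebra set \<Rightarrow> 'a set"
  where "generated_cstar_subalgebra S = \<Inter> {B. cstar_subalgebra B \<and> S \<subseteq> B}"

definition star_representation ::
    "('a :: cstar_algebra \<Rightarrow> 'h :: complex_hilbert_space \<Rightarrow>\<^sub>L 'h) \<Rightarrow> bool"
  where "star_representation \<rho> \<longleftrightarrow>
    range \<rho> \<subseteq> bounded_operators \<and>
    (\<forall>a b. \<rho> (a + b) = \<rho> a + \<rho> b) \<and>
    (\<forall>c a x. blinfun_apply (\<rho> (c *\<^sub>C a)) x = c *\<^sub>C blinfun_apply (\<rho> a) x) \<and>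
    (\<forall>a b. \<rho> (a * b) = \<rho> a o\<^sub>L \<rho> b) \<and>
    \<rho> 1 = id_blinfun \<and>
    (\<forall>a. is_adjoint (\<rho> (star a)) (\<rho> a))"

text \<open>\<open>universal_rotation_algebra \<theta> u v\<close>: the ambient C*-algebra is the universal C*-algebra
  generated by unitaries \<open>u\<close>, \<open>v\<close> with \<open>v u = exp (2 \<pi> i \<theta>) u v\<close>. A HOL formula cannot quantify
  over all target C*-algebras of all types, but it is enough to test the universal property on
  \<open>B(\<ell>\<^sup>2)\<close>: if unitaries \<open>U\<close>, \<open>V\<close> in a C*-algebra satisfy the relation, then the C*-algebra they
  generate is separable and hence faithfully represented on a separable Hilbert space, which may be
  taken to be \<open>\<ell>\<^sup>2\<close> after passing to an infinite multiple. The homomorphism extending \<open>u \<mapsto> U\<close>,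
  \<open>v \<mapsto> V\<close> is unique because \<open>u\<close> and \<open>v\<close> generate.\<close>

definition universal_rotation_algebra :: "real \<Rightarrow> 'a :: cstar_algebra \<Rightarrow> 'a \<Rightarrow> bool"
  where "universal_rotation_algebra \<theta> u v \<longleftrightarrow>
    unitary_element u \<and> unitary_element v \<and>
    v * u = cis (2 * pi * \<theta>) *\<^sub>C (u * v) \<and>
    generated_cstar_subalgebra {u, v} = UNIV \<and>
    (\<forall>U V :: ell2 \<Rightarrow>\<^sub>L ell2.
      unitary_operator U \<and> unitary_operator V \<and>
      (\<forall>x. blinfun_apply (V o\<^sub>L U) x = cis (2 * pi * \<theta>) *\<^sub>C blinfun_apply (U o\<^sub>L V) x) \<longrightarrow>
      (\<exists>\<rho> :: 'a \<Rightarrow> ell2 \<Rightarrow>\<^sub>L ell2. star_representation \<rho> \<and> \<rho> u = U \<and> \<rho> v = V))"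

definition tracial_state :: "('a :: cstar_algebra \<Rightarrow> complex) \<Rightarrow> bool"
  where "tracial_state \<tau> \<longleftrightarrow>
    (\<forall>a b. \<tau> (a + b) = \<tau> a + \<tau> b) \<and>
    (\<forall>c a. \<tau> (c *\<^sub>C a) = c * \<tau> a) \<and>
    (\<forall>a. \<tau> (star a * a) \<in> \<real>\<^sub>\<ge>\<^sub>0) \<and>
    \<tau> 1 = 1 \<and>
    (\<forall>a b. \<tau> (a * b) = \<tau> (b * a))"

text \<open>\<open>gns_construction \<tau> \<Lambda> \<pi>\<close>: the Hilbert space \<open>'h\<close>, with the canonical map \<open>\<Lambda>\<close> from the
  algebra, is \<open>L\<^sup>2(A, \<tau>)\<close>, that is, the Hausdorff completion of \<open>A\<close> for the sesquilinear form
  \<open>\<tau> (b\<^sup>* a)\<close>, and \<open>\<pi>\<close> is the extension of left multiplication.\<close>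

definition gns_construction ::
    "('a :: cstar_algebra \<Rightarrow> complex) \<Rightarrow> ('a \<Rightarrow> 'h :: complex_hilbert_space) \<Rightarrow>
     ('a \<Rightarrow> 'h \<Rightarrow>\<^sub>L 'h) \<Rightarrow> bool"
  where "gns_construction \<tau> \<Lambda> \<pi> \<longleftrightarrow>
    (\<forall>a b. \<Lambda> (a + b) = \<Lambda> a + \<Lambda> b) \<and>
    (\<forall>c a. \<Lambda> (c *\<^sub>C a) = c *\<^sub>C \<Lambda> a) \<and>
    (\<forall>a b. cinner (\<Lambda> a) (\<Lambda> b) = \<tau> (star b * a)) \<and>
    closure (range \<Lambda>) = UNIV \<and>
    range \<pi> \<subseteq> bounded_operators \<and>
    (\<forall>a b. blinfun_apply (\<pi> a) (\<Lambda> b) = \<Lambda> (a * b))"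

end

theory Submission
  imports Defs
begin

text \<open>Write \<open>x n k\<close> for the coefficient of \<open>e \<Lambda>(1)\<close> at the basis vector \<open>\<Lambda>(u\<^sup>n v\<^sup>k)\<close>. If \<open>e \<in> R\<close> commutes
  with \<open>u + v\<close>, then \<open>(1 - \<mu>\<^sup>k) x (n - 1) k = (1 - \<mu>\<^sup>n) x n (k - 1)\<close>, a recurrence on each antidiagonal
  \<open>n + k = N\<close>. For \<open>N \<ge> 0\<close> its solutions are the multiples of the coefficients of \<open>(u + v)\<^sup>N\<close>. For
  \<open>N = - 1\<close> their modulus is constant on each half line, so that square summability forces them to
  vanish, and multiplication by \<open>u + v\<close> reduces \<open>N < - 1\<close> to \<open>N + 1\<close>. Hence \<open>e\<close> is determined by a
  formal power series in \<open>u + v\<close>; since complex power series form a domain, an idempotent one is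
  \<open>0\<close> or \<open>1\<close>.\<close>

section \<open>Complex inner products\<close>

lemma scaleC_one [simp]: "1 *\<^sub>C x = (x :: 'a :: complex_normed_vector)"
  using scaleC_of_real[of 1 x] by simp

lemma scaleC_zero_left [simp]: "0 *\<^sub>C x = (0 :: 'a :: complex_normed_vector)"
  using scaleC_of_real[of 0 x] by simp

lemma scaleC_minus_one: "(- 1) *\<^sub>C x = - (x :: 'a :: complex_normed_vector)"
  using scaleC_of_real[of "- 1" x] by simp

lemma scaleC_scaleR_commute: "c *\<^sub>C (r *\<^sub>R x) = r *\<^sub>R (c *\<^sub>C (x :: 'a :: complex_normed_vector))"
  by (simp add: scaleC_scaleC mult.commute flip: scaleC_of_real)

lemma scaleC_diff_right: "c *\<^sub>C (x - y) = c *\<^sub>C x - c *\<^sub>C (y :: 'a :: complex_normed_vector)"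
  using scaleC_add_right[of c "x - y" y] by (simp add: algebra_simps)

lemma bounded_linear_scaleC: "bounded_linear (\<lambda>x :: 'a :: complex_normed_vector. c *\<^sub>C x)"
  by (rule bounded_linear_intro[where K = "cmod c"])
    (auto simp: scaleC_add_right scaleC_scaleR_commute norm_scaleC)

lemma cinner_zero_left [simp]: "cinner 0 x = 0"
  using cinner_add_left[of 0 0 x] by simp

lemma cinner_add_right: "cinner x (y + z) = cinner x y + cinner x z"
  using cinner_add_left[of y z x] cinner_commute[of x] by simp

lemma cinner_scaleC_right: "cinner x (c *\<^sub>C y) = cnj c * cinner x y"
  using cinner_scaleC_left[of c y x] cinner_commute[of x] by simp

lemma cinner_zero_right [simp]: "cinner x 0 = 0"
  using cinner_commute[of x 0] by simp

lemma cinner_minus_left: "cinner (- x) y = - cinner x y"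
  using cinner_scaleC_left[of "- 1" x y] by (simp add: scaleC_minus_one)

lemma cinner_minus_right: "cinner x (- y) = - cinner x y"
  using cinner_scaleC_right[of x "- 1" y] by (simp add: scaleC_minus_one)

lemma cinner_diff_left: "cinner (x - y) z = cinner x z - cinner y z"
  using cinner_add_left[of x "- y" z] by (simp add: cinner_minus_left)

lemma norm_add_orthogonal:
  assumes "cinner x y = 0"
  shows "(norm (x + y))\<^sup>2 = (norm x)\<^sup>2 + (norm y)\<^sup>2"
proof -
  have "cinner y x = 0" using assms cinner_commute[of y x] by simp
  then have "cinner (x + y) (x + y) = cinner x x + cinner y y"
    using assms by (simp add: cinner_add_left cinner_add_right)
  then have "complex_of_real ((norm (x + y))\<^sup>2) = complex_of_real ((norm x)\<^sup>2 + (norm y)\<^sup>2)"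
    by (simp only: cinner_self of_real_add)
  then show ?thesis by (simp only: of_real_eq_iff)
qed

lemma cinner_Cauchy_Schwarz: "cmod (cinner x y) \<le> norm x * norm y"
proof (cases "y = 0")
  case False
  \<comment> \<open>\<open>c *\<^sub>C y\<close> is the orthogonal projection of \<open>x\<close>
    onto the line through \<open>y\<close>, so Pythagoras bounds its norm by
    \<open>norm x\<close>.\<close>
  define c where "c = cinner x y / complex_of_real ((norm y)\<^sup>2)"
  have "cinner (x - c *\<^sub>C y) (c *\<^sub>C y) = 0"
    using False by (simp add: cinner_diff_left cinner_scaleC_left cinner_scaleC_right c_def cinner_self)
  from norm_add_orthogonal[OF this] have "(norm x)\<^sup>2 \<ge> (cmod c * norm y)\<^sup>2"
    by (simp add: norm_scaleC)
  then have "cmod c * norm y \<le> norm x"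
    by (rule power2_le_imp_le) simp
  moreover have "cmod c = cmod (cinner x y) / (norm y)\<^sup>2"
    by (simp add: c_def norm_divide norm_power)
  ultimately show ?thesis
    using False by (simp add: field_simps power2_eq_square)
qed simp

lemma bounded_linear_cinner_left: "bounded_linear (\<lambda>x. cinner x y)"
  by (rule bounded_linear_intro[where K = "norm y"])
    (auto simp: cinner_add_left cinner_scaleC_left cinner_Cauchy_Schwarz scaleR_conv_of_real
      simp flip: scaleC_of_real)

lemma bounded_linear_cinner_right: "bounded_linear (\<lambda>y. cinner x y)"
  by (rule bounded_linear_intro[where K = "norm x"])
    (auto simp: cinner_add_right cinner_scaleC_right scaleR_conv_of_real
      intro: order_trans[OF cinner_Cauchy_Schwarz] simp flip: scaleC_of_real)

lemma cinner_zero_on_span: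
  assumes "p \<in> span A" "\<And>a. a \<in> A \<Longrightarrow> cinner x a = 0"
  shows "cinner x p = 0"
  using assms(2,1)
  by (rule linear_eq_0_on_span[OF bounded_linear.linear[OF bounded_linear_cinner_right]])

section \<open>Total orthonormal families\<close>

text \<open>\<open>span\<close> is taken over the reals, so all complex multiples of the basis
  vectors are put in to obtain the complex span.\<close>

locale total_orthonormal =
  fixes b :: "'i \<Rightarrow> 'h :: complex_hilbert_space"
  assumes orthonormal: "cinner (b i) (b j) = of_bool (i = j)"
    and total: "closure (span (\<Union>i. range (\<lambda>c. c *\<^sub>C b i))) = UNIV"
begin

lemma approx:
  assumes "\<epsilon> > 0"
  obtains p where "p \<in> span (\<Union>i. range (\<lambda>c. c *\<^sub>C b i))" "norm (x - p) < \<epsilon>"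
proof -
  have "x \<in> closure (span (\<Union>i. range (\<lambda>c. c *\<^sub>C b i)))" by (simp add: total)
  then obtain p where "p \<in> span (\<Union>i. range (\<lambda>c. c *\<^sub>C b i))" "dist p x < \<epsilon>"
    using assms unfolding closure_approachable by blast
  then show ?thesis using that by (simp add: dist_norm norm_minus_commute)
qed

lemma norm_basis: "norm (b i) = 1"
proof -
  have "complex_of_real ((norm (b i))\<^sup>2) = 1"
    using orthonormal[of i i] cinner_self[of "b i"] by simp
  then have "(norm (b i))\<^sup>2 = 1" by (simp only: of_real_eq_1_iff)
  then show ?thesis by (simp add: power2_eq_1_iff) (smt (verit) norm_ge_zero)
qed

text \<open>Approximate \<open>x\<close> within \<epsilon> by a finite combination \<open>p\<close>:
  off the finite support of \<open>p\<close> the coefficients of \<open>x\<close> are those of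
  \<open>x - p\<close>, hence small. This weak form of square summability is the decay used with the
  recurrence.\<close>

lemma finite_large_coefficients:
  assumes "\<epsilon> > 0"
  shows "finite {i. \<epsilon> \<le> cmod (cinner x (b i))}"
proof -
  obtain p where p: "p \<in> span (\<Union>i. range (\<lambda>c. c *\<^sub>C b i))" "norm (x - p) < \<epsilon>"
    using approx[OF assms] .
  have "finite {i. cinner p (b i) \<noteq> 0}"
    using p(1)
  proof (induction rule: span_induct_alt)
    case (step r a y)
    then obtain c j where a: "a = c *\<^sub>C b j" by blast
    have "{i. cinner (r *\<^sub>R a + y) (b i) \<noteq> 0} \<subseteq> insert j {i. cinner y (b i) \<noteq> 0}"
      by (auto simp: a cinner_add_left cinner_scaleC_left orthonormal simp flip: scaleC_of_real)
    then show ?case using step(2) by (meson finite_insert finite_subset)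
  qed simp
  moreover have "cinner p (b i) \<noteq> 0" if "\<epsilon> \<le> cmod (cinner x (b i))" for i
  proof
    assume "cinner p (b i) = 0"
    then have "cmod (cinner x (b i)) = cmod (cinner (x - p) (b i))"
      by (simp add: cinner_diff_left)
    also have "\<dots> \<le> norm (x - p)"
      using cinner_Cauchy_Schwarz[of "x - p" "b i"] by (simp add: norm_basis)
    finally show False using that p(2) by simp
  qed
  then have "{i. \<epsilon> \<le> cmod (cinner x (b i))} \<subseteq> {i. cinner p (b i) \<noteq> 0}" by blast
  ultimately show ?thesis by (rule rev_finite_subset)
qed

text \<open>Every term \<open>cinner x (b i) * \<phi> (b i)\<close> of the formal expansion of
  \<open>\<phi> x\<close> is zero. To avoid infinite sums, an approximant of \<open>x\<close> is
  split into a part \<open>p1\<close> killed by \<phi> and a part \<open>p2\<close> orthogonal to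
  both \<open>x\<close> and \<open>p1\<close>.\<close>

lemma functional_vanishes:
  fixes \<phi> :: "'h \<Rightarrow> complex"
  assumes "bounded_linear \<phi>"
    and scale: "\<And>c x. \<phi> (c *\<^sub>C x) = c * \<phi> x"
    and split: "\<And>i. cinner x (b i) = 0 \<or> \<phi> (b i) = 0"
  shows "\<phi> x = 0"
proof -
  interpret \<phi>: bounded_linear \<phi> by fact
  define A where "A = (\<Union>i\<in>{i. \<phi> (b i) = 0}. range (\<lambda>c. c *\<^sub>C b i))"
  define B where "B = (\<Union>i\<in>{i. \<phi> (b i) \<noteq> 0}. range (\<lambda>c. c *\<^sub>C b i))"
  obtain K where K: "0 < K" "\<And>y. cmod (\<phi> y) \<le> norm y * K" using \<phi>.pos_bounded by blast
  have "cmod (\<phi> x) \<le> 0 + \<epsilon>" if "\<epsilon> > 0" for \<epsilon>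
  proof -
    obtain p where p: "p \<in> span (\<Union>i. range (\<lambda>c. c *\<^sub>C b i))" "norm (x - p) < \<epsilon> / K"
      using approx[of "\<epsilon> / K" x] \<open>\<epsilon> > 0\<close> K(1) by (metis divide_pos_pos)
    have "(\<Union>i. range (\<lambda>c. c *\<^sub>C b i)) = A \<union> B" by (auto simp: A_def B_def)
    then obtain p1 p2 where p12: "p = p1 + p2" "p1 \<in> span A" "p2 \<in> span B"
      using p(1) by (auto simp: span_Un)
    have "\<phi> p1 = 0"
      by (rule linear_eq_0_on_span[OF \<phi>.linear_axioms _ p12(2)]) (auto simp: A_def scale)
    have "cinner q p1 = 0" if q: "q \<in> B" for q
      using p12(2) by (rule cinner_zero_on_span)
        (use q in \<open>auto simp: A_def B_def cinner_scaleC_left cinner_scaleC_right orthonormal\<close>)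
    moreover have "cinner x q = 0" if "q \<in> B" for q
      using that split by (fastforce simp: B_def cinner_scaleC_right)
    ultimately have "cinner (x - p1) q = 0" if "q \<in> B" for q
      using that cinner_commute[of p1 q] by (simp add: cinner_diff_left)
    with p12(3) have "cinner (x - p1) p2 = 0" by (rule cinner_zero_on_span)
    then have "cinner (x - p1) (- p2) = 0" by (simp add: cinner_minus_right)
    \<comment> \<open>By Pythagoras, dropping \<open>p2\<close> does not worsen the approximation of
      \<open>x\<close>.\<close>
    then have "(norm ((x - p1) + (- p2)))\<^sup>2 = (norm (x - p1))\<^sup>2 + (norm (- p2))\<^sup>2"
      by (rule norm_add_orthogonal)
    also have "(x - p1) + (- p2) = x - p" by (simp add: p12(1))
    finally have "(norm (x - p1))\<^sup>2 \<le> (norm (x - p))\<^sup>2" by simp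
    then have le: "norm (x - p1) \<le> norm (x - p)" by (rule power2_le_imp_le) simp
    have "cmod (\<phi> x) = cmod (\<phi> (x - p1))" by (simp add: \<phi>.diff \<open>\<phi> p1 = 0\<close>)
    also have "\<dots> \<le> norm (x - p1) * K" by (rule K)
    also have "\<dots> \<le> \<epsilon> / K * K" using le p(2) K(1) by (intro mult_right_mono) auto
    finally show ?thesis using K(1) by simp
  qed
  then have "cmod (\<phi> x) \<le> 0" by (rule field_le_epsilon)
  then show ?thesis by simp
qed

lemma zero_if_coefficients_zero:
  assumes "\<And>i. cinner x (b i) = 0"
  shows "x = 0"
proof -
  have "cinner x x = 0"
    using bounded_linear_cinner_left cinner_scaleC_left assms
    by (intro functional_vanishes) auto
  then show ?thesis by (simp add: cinner_self)
qed

end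

section \<open>C*-algebras\<close>

instance cstar_algebra \<subseteq> banach ..

lemma star_one [simp]: "star (1 :: 'a :: cstar_algebra) = 1"
  using star_mult[of "1 :: 'a" "star 1"] by (simp add: star_star)

lemma norm_star [simp]: "norm (star a) = norm (a :: 'a :: cstar_algebra)"
proof -
  have "norm a \<le> norm (star a)" for a :: 'a
  proof (cases "a = 0")
    case False
    have "norm a * norm a \<le> norm (star a) * norm a"
      using norm_mult_ineq[of "star a" a] cstar_identity[of a] by (simp add: power2_eq_square)
    then show ?thesis using False by simp
  qed simp
  from this[of a] this[of "star a"] show ?thesis by (simp add: star_star)
qed

lemma star_scaleR: "star (r *\<^sub>R a) = r *\<^sub>R star (a :: 'a :: cstar_algebra)"
  by (simp add: star_scaleC flip: scaleC_of_real)

lemma bounded_linear_star: "bounded_linear (star :: 'a :: cstar_algebra \<Rightarrow> 'a)"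
  by (rule bounded_linear_intro[where K = 1]) (auto simp: star_add star_scaleR)

lemma star_power: "star (a ^ n) = star (a :: 'a :: cstar_algebra) ^ n"
  by (induction n) (simp_all add: star_mult power_commutes)

text \<open>Consecutive coefficients differ by the factor \<open>(1/2 - n) / (n + 1)\<close>, of
  modulus at most 1. The bound lets a geometric series dominate the binomial series of the square
  root.\<close>

lemma abs_gbinomial_half_le_1: "\<bar>(1/2 :: real) gchoose n\<bar> \<le> 1"
proof (induction n)
  case (Suc n)
  have "(1/2 :: real) gchoose Suc n = ((1/2) gchoose n) * ((1/2 - real n) / (real n + 1))"
    using gbinomial_mult_1[of "1/2 :: real" n] by (simp add: field_simps)
  moreover have "\<bar>(1/2 - real n) / (real n + 1)\<bar> \<le> 1" by (simp add: field_simps abs_le_iff)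
  ultimately show ?case
    using Suc mult_mono[of "\<bar>(1/2 :: real) gchoose n\<bar>" 1 "\<bar>(1/2 - real n) / (real n + 1)\<bar>" 1]
    by (simp add: abs_mult)
qed simp

text \<open>The binomial series with exponent 1/2 serves as \<open>d\<close>. Vandermonde's identity
  turns its Cauchy square into the series with exponent 1, which stops after \<open>1 - x\<close>;
  real coefficients keep the sum self-adjoint.\<close>

lemma self_adjoint_sqrt_exists:
  fixes x :: "'a :: cstar_algebra"
  assumes "norm x < 1" "star x = x"
  obtains d where "star d = d" "d * d = 1 - x"
proof -
  define f where "f n = ((1/2 :: real) gchoose n) *\<^sub>R (- x) ^ n" for n
  have summable: "summable (\<lambda>n. norm (f n))"
  proof (rule summable_comparison_test')
    show "summable (\<lambda>n. norm x ^ n)" using assms(1) by (simp add: summable_geometric)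
    fix n :: nat
    have "norm (f n) \<le> 1 * norm (- x) ^ n"
      unfolding f_def norm_scaleR real_norm_def
      by (intro mult_mono abs_gbinomial_half_le_1 norm_power_ineq) auto
    then show "norm (norm (f n)) \<le> norm x ^ n" by simp
  qed
  have "(\<Sum>i\<le>n. f i * f (n - i)) = (1 gchoose n) *\<^sub>R (- x) ^ n" for n
  proof -
    have "f i * f (n - i) = (((1/2) gchoose i) * ((1/2) gchoose (n - i))) *\<^sub>R (- x) ^ n"
      if "i \<le> n" for i
      using that by (simp add: f_def flip: power_add)
    then have "(\<Sum>i\<le>n. f i * f (n - i))
        = (\<Sum>i\<le>n. ((1/2) gchoose i) * ((1/2) gchoose (n - i))) *\<^sub>R (- x) ^ n"
      by (simp add: scaleR_left.sum)
    then show ?thesis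
      using gbinomial_Vandermonde[of "1/2 :: real" "1/2" n] by (simp add: atLeast0AtMost)
  qed
  then have "(\<lambda>n. (1 gchoose n) *\<^sub>R (- x) ^ n) sums (suminf f * suminf f)"
    using Cauchy_product_sums[OF summable summable] by simp
  moreover have "(\<lambda>n. (1 gchoose n) *\<^sub>R (- x) ^ n) sums (\<Sum>n\<in>{0, 1}. (1 gchoose n) *\<^sub>R (- x) ^ n)"
  proof (rule sums_finite)
    fix n :: nat assume "n \<notin> {0, 1}"
    then have "(1 :: nat) choose n = 0" by (intro binomial_eq_0) auto
    then have "(1 :: real) gchoose n = 0" by (metis binomial_gbinomial of_nat_0 of_nat_1)
    then show "((1 :: real) gchoose n) *\<^sub>R (- x) ^ n = 0" by simp
  qed simp
  ultimately have "suminf f * suminf f = 1 - x" by (simp add: sums_iff)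
  moreover have "star (suminf f) = suminf f"
  proof -
    have "star (- x) = - x"
      using linear_neg[OF bounded_linear.linear[OF bounded_linear_star], of x] assms(2) by simp
    then have "star (f n) = f n" for n by (simp add: f_def star_scaleR star_power)
    then show ?thesis
      using bounded_linear.suminf[OF bounded_linear_star summable_norm_cancel[OF summable]] by simp
  qed
  ultimately show ?thesis using that by blast
qed

section \<open>Integer powers of unitaries\<close>

text \<open>Negative powers are powers of \<open>star u\<close>, which is the inverse of
  \<open>u\<close> when \<open>u\<close> is unitary.\<close>

definition unitary_powi :: "'a :: cstar_algebra \<Rightarrow> int \<Rightarrow> 'a"
  where "unitary_powi u n = (if 0 \<le> n then u ^ nat n else star u ^ nat (- n))"

lemma unitary_powi_0 [simp]: "unitary_powi u 0 = 1"
  by (simp add: unitary_powi_def)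

lemma unitary_powi_1 [simp]: "unitary_powi u 1 = u"
  by (simp add: unitary_powi_def)

lemma unitary_powi_minus_1 [simp]: "unitary_powi u (- 1) = star u"
  by (simp add: unitary_powi_def)

lemma star_unitary_powi: "star (unitary_powi u n) = unitary_powi u (- n)"
  by (auto simp: unitary_powi_def star_power star_star)

context
  fixes u :: "'a :: cstar_algebra"
  assumes u: "unitary_element u"
begin

lemma unitary_cancel: "star u * (u * x) = x" "u * (star u * x) = x"
  using u by (simp_all add: unitary_element_def flip: mult.assoc)

lemma unitary_powi_succ: "unitary_powi u (n + 1) = u * unitary_powi u n"
proof (cases "0 \<le> n")
  case True
  then show ?thesis by (simp add: unitary_powi_def nat_add_distrib)
next
  case False
  define m where "m = nat (- n - 1)"
  have n: "n = - int m - 1" using False by (simp add: m_def)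
  have "nat (1 + int m) = Suc m" by simp
  then show ?thesis by (auto simp: n unitary_powi_def unitary_cancel)
qed

lemma unitary_powi_pred: "unitary_powi u (n - 1) = star u * unitary_powi u n"
  using unitary_powi_succ[of "n - 1"] by (simp add: unitary_cancel)

lemma unitary_powi_add: "unitary_powi u (m + n) = unitary_powi u m * unitary_powi u n"
proof (induction m rule: int_induct[where k = 0])
  case (step1 i)
  then show ?case
    using unitary_powi_succ[of "i + n"] unitary_powi_succ[of i] by (simp add: mult.assoc algebra_simps)
next
  case (step2 i)
  then show ?case
    using unitary_powi_pred[of "i + n"] unitary_powi_pred[of i] by (simp add: mult.assoc algebra_simps)
qed simp

lemma unitary_powi_twisted_commute:
  assumes yu: "y * u = c *\<^sub>C (u * y)" and "c \<noteq> 0"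
  shows "y * unitary_powi u n = (c powi n) *\<^sub>C (unitary_powi u n * y)"
proof (induction n rule: int_induct[where k = 0])
  case (step1 i)
  have "y * unitary_powi u (i + 1) = c *\<^sub>C (u * (y * unitary_powi u i))"
    by (simp add: unitary_powi_succ yu scaleC_mult_left flip: mult.assoc)
  then show ?case
    using \<open>c \<noteq> 0\<close> step1(2)
    by (simp add: unitary_powi_succ scaleC_mult_right scaleC_scaleC power_int_add mult.assoc mult.commute)
next
  case (step2 i)
  \<comment> \<open>Multiplying the relation by \<open>star u\<close> on the right shows that
    \<open>y\<close> commutes with \<open>star u\<close> up to the inverse scalar.\<close>
  have "u * (y * star u) = inverse c *\<^sub>C ((c *\<^sub>C (u * y)) * star u)"
    using \<open>c \<noteq> 0\<close> by (simp add: scaleC_mult_left scaleC_scaleC mult.assoc)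
  also have "\<dots> = inverse c *\<^sub>C y"
    using u by (simp flip: yu add: mult.assoc unitary_element_def)
  finally have "y * star u = inverse c *\<^sub>C (star u * y)"
    using unitary_cancel(1)[of "y * star u"] by (simp add: scaleC_mult_right)
  then have "y * unitary_powi u (i - 1) = inverse c *\<^sub>C (star u * (y * unitary_powi u i))"
    by (simp add: unitary_powi_pred scaleC_mult_left flip: mult.assoc)
  then show ?case
    using \<open>c \<noteq> 0\<close> step2(2)
    by (simp add: unitary_powi_pred scaleC_mult_right scaleC_scaleC power_int_diff mult.assoc field_simps)
qed simp

end

section \<open>A recurrence on the antidiagonals\<close>

locale circle_irrational =
  fixes \<mu> :: complex
  assumes norm_base: "cmod \<mu> = 1"
    and not_root_of_unity: "n \<noteq> 0 \<Longrightarrow> \<mu> powi n \<noteq> 1"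
begin

lemma base_nonzero: "\<mu> \<noteq> 0"
  using norm_base by auto

lemma norm_powi: "cmod (\<mu> powi n) = 1"
  by (simp add: norm_power_int norm_base)

lemma decaying_sequence_zero:
  fixes y :: "int \<Rightarrow> complex"
  assumes decay: "\<And>\<epsilon>. 0 < \<epsilon> \<Longrightarrow> finite {k. \<epsilon> \<le> cmod (y k)}"
    and "infinite I" "\<And>k. k \<in> I \<Longrightarrow> cmod (y k) = c"
    and "l \<in> I"
  shows "y l = 0"
proof (rule ccontr)
  assume "y l \<noteq> 0"
  then have "c > 0" using assms(3)[OF \<open>l \<in> I\<close>] by auto
  moreover have "I \<subseteq> {k. c \<le> cmod (y k)}" using assms(3) by auto
  ultimately show False using decay \<open>infinite I\<close> by (meson finite_subset)
qed

text \<open>Multiplication by \<open>u + v\<close> maps solutions of degree \<open>- m - 2\<close> to solutions of degree \<open>- m - 1\<close>,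
  which vanish by induction; then consecutive entries of \<open>y\<close> have the same modulus and decay applies.\<close>

lemma negative_degree_zero:
  fixes y :: "int \<Rightarrow> complex" and m :: nat
  assumes "\<And>k. (1 - \<mu> powi k) * y k = (1 - \<mu> powi (- int m - k)) * y (k - 1)"
    and "\<And>\<epsilon>. 0 < \<epsilon> \<Longrightarrow> finite {k. \<epsilon> \<le> cmod (y k)}"
  shows "y k = 0"
  using assms
proof (induction m arbitrary: y k)
  case 0
  have "cmod (y k) = cmod (y (k - 1))" if "k \<noteq> 0" for k
  proof -
    \<comment> \<open>In degree -1 the two factors of the recurrence differ by a unimodular number,
      so \<open>1 - \<mu> powi k\<close> cancels unless \<open>k = 0\<close>.\<close>
    have "1 - \<mu> powi (- k) = - (\<mu> powi (- k)) * (1 - \<mu> powi k)"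
      using base_nonzero by (simp add: algebra_simps flip: power_int_add)
    with 0(1)[of k] have "(1 - \<mu> powi k) * y k = (1 - \<mu> powi k) * (- (\<mu> powi (- k)) * y (k - 1))"
      by (simp add: algebra_simps)
    then have "y k = - (\<mu> powi (- k)) * y (k - 1)"
      by (rule mult_left_cancel[THEN iffD1, rotated]) (use not_root_of_unity[OF that] in simp)
    then have "cmod (y k) = cmod (- (\<mu> powi (- k))) * cmod (y (k - 1))" by (simp only: norm_mult)
    then show ?thesis by (simp only: norm_minus_cancel norm_powi)
  qed
  note eq = this
  \<comment> \<open>At \<open>k = 0\<close> the recurrence is void and does not link
    \<open>y 0\<close> to \<open>y (- 1)\<close>, hence two half lines with separate
    constants.\<close>
  have pos: "cmod (y j) = cmod (y 0)" if "j \<in> {0..}" for j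
  proof -
    from that have "0 \<le> j" by simp
    then show ?thesis
    proof (induction j rule: int_ge_induct)
      case (step i)
      then show ?case using eq[of "i + 1"] by simp
    qed simp
  qed
  have neg: "cmod (y j) = cmod (y (- 1))" if "j \<in> {..- 1}" for j
  proof -
    from that have "j \<le> - 1" by simp
    then show ?thesis
    proof (induction j rule: int_le_induct)
      case (step i)
      then show ?case using eq[of i] by simp
    qed simp
  qed
  have "k \<in> {0..} \<or> k \<in> {..- 1}" by auto
  then show ?case
    using decaying_sequence_zero[OF 0(2) infinite_Ici pos]
      decaying_sequence_zero[OF 0(2) infinite_Iic neg] by blast
next
  case (Suc m)
  \<comment> \<open>Coefficient at \<open>u^(- m - 1 - k) v^k\<close> of \<open>u + v\<close> times
    the formal sum of the terms \<open>y k u^(- m - 2 - k) v^k\<close>; the power of \<mu> comes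
    from moving \<open>v\<close> past a power of \<open>u\<close>.\<close>
  define z where "z k = y k + \<mu> powi (- int (Suc m) - k) * y (k - 1)" for k
  have z: "z k = 0" for k
  proof (rule Suc.IH)
    fix k
    let ?s = "\<mu> powi (- int (Suc m))" and ?a = "\<mu> powi k" and ?b = "\<mu> powi (- int m - k)"
    have add: "\<mu> powi i * \<mu> powi j = \<mu> powi (i + j)" for i j
      using base_nonzero by (simp add: power_int_add)
    have 1: "\<mu> powi (- int (Suc m) - k) * ?a = ?s"
      unfolding add by simp
    have 2: "\<mu> powi (- int (Suc m) - (k - 1)) = ?b" by (simp add: algebra_simps)
    have 3: "\<mu> powi (k - 1) * ?b = ?s" unfolding add by (simp add: algebra_simps)
    have "(1 - ?a) * z k = (1 - ?a) * y k + (\<mu> powi (- int (Suc m) - k) - ?s) * y (k - 1)"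
      using 1 by (simp add: z_def algebra_simps )
    also have "(1 - ?a) * y k = (1 - \<mu> powi (- int (Suc m) - k)) * y (k - 1)"
      by (rule Suc.prems)
    \<comment> \<open>Both sides of the recurrence for \<open>z\<close> turn out to be
      \<open>(1 - ?s) * y (k - 1)\<close>.\<close>
    finally have "(1 - ?a) * z k = (1 - ?s) * y (k - 1)"
      by (simp add: algebra_simps)
    moreover have "(1 - ?b) * z (k - 1) = (1 - ?s) * y (k - 1)"
    proof -
      have "(1 - ?b) * z (k - 1) = (1 - ?b) * y (k - 1) + ?b * ((1 - ?b) * y (k - 1 - 1))"
        by (simp add: z_def 2 algebra_simps)
      also have "(1 - ?b) * y (k - 1 - 1) = (1 - \<mu> powi (k - 1)) * y (k - 1)"
        using Suc.prems(1)[of "k - 1"] by (simp add: 2)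
      finally show ?thesis using 3 by (simp add: algebra_simps)
    qed
    ultimately show "(1 - ?a) * z k = (1 - ?b) * z (k - 1)" by simp
  next
    fix \<epsilon> :: real assume "0 < \<epsilon>"
    let ?Y = "{k. \<epsilon> / 2 \<le> cmod (y k)}"
    have "{k. \<epsilon> \<le> cmod (z k)} \<subseteq> ?Y \<union> (\<lambda>k. k + 1) ` ?Y"
    proof
      fix k assume "k \<in> {k. \<epsilon> \<le> cmod (z k)}"
      moreover have "cmod (z k) \<le> cmod (y k) + cmod (y (k - 1))"
        unfolding z_def by (rule norm_triangle_le) (simp add: norm_mult norm_powi)
      ultimately have "k \<in> ?Y \<or> k - 1 \<in> ?Y" by auto
      then show "k \<in> ?Y \<union> (\<lambda>k. k + 1) ` ?Y" by (auto intro: image_eqI[of _ _ "k - 1"])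
    qed
    moreover have "finite ?Y" using \<open>0 < \<epsilon>\<close> by (intro Suc.prems(2)) simp
    ultimately show "finite {k. \<epsilon> \<le> cmod (z k)}" by (meson finite_UnI finite_imageI finite_subset)
  qed
  have eq: "cmod (y k) = cmod (y (k - 1))" for k
  proof -
    have "y k = - (\<mu> powi (- int (Suc m) - k)) * y (k - 1)"
      using z[of k] by (simp add: z_def eq_neg_iff_add_eq_0)
    then have "cmod (y k) = cmod (- (\<mu> powi (- int (Suc m) - k))) * cmod (y (k - 1))"
      by (simp only: norm_mult)
    then show ?thesis by (simp only: norm_minus_cancel norm_powi)
  qed
  have "cmod (y k) = cmod (y 0)" for k
  proof (induction k rule: int_induct[where k = 0])
    case (step1 i)
    then show ?case using eq[of "i + 1"] by simp
  next
    case (step2 i)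
    then show ?case using eq[of i] by simp
  qed simp
  from decaying_sequence_zero[OF Suc.prems(2) infinite_UNIV_int this]
  show ?case by simp
qed

text \<open>The factor on the left vanishes only at \<open>k = 0\<close>, the one on the right only
  at \<open>k = N + 1\<close>. There the recurrence forces \<open>y (- 1) = 0\<close> and
  \<open>y (N + 1) = 0\<close>, and these zeros propagate downwards and upwards. In between, each
  entry is determined by its predecessor, hence by \<open>y 0\<close>.\<close>

lemma
  fixes y :: "int \<Rightarrow> complex"
  assumes rec: "\<And>k. (1 - \<mu> powi k) * y k = (1 - \<mu> powi (N + 1 - k)) * y (k - 1)"
    and N: "0 \<le> N"
  shows nonneg_degree_below: "k < 0 \<Longrightarrow> y k = 0"
    and nonneg_degree_above: "N < k \<Longrightarrow> y k = 0"
    and nonneg_degree_zero: "y 0 = 0 \<Longrightarrow> y k = 0"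
proof -
  have up: "y (k + 1) = 0" if "y k = 0" "k + 1 \<noteq> 0" for k
    using rec[of "k + 1"] that not_root_of_unity[of "k + 1"] by simp
  show below: "y k = 0" if "k < 0" for k
  proof -
    from that have "k \<le> - 1" by simp
    then show ?thesis
    proof (induction k rule: int_le_induct)
      case base
      show ?case using rec[of 0] not_root_of_unity[of "N + 1"] N by simp
    next
      case (step i)
      then show ?case using rec[of i] not_root_of_unity[of "N + 1 - i"] N by simp
    qed
  qed
  show "y k = 0" if "N < k"
  proof -
    from that have "N + 1 \<le> k" by simp
    then show ?thesis
    proof (induction k rule: int_ge_induct)
      case base
      show ?case using rec[of "N + 1"] not_root_of_unity[of "N + 1"] N by simp
    next
      case (step i)
      then show ?case using up[of i] N by simp
    qed
  qed
  show "y k = 0" if "y 0 = 0"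
  proof (cases "k < 0")
    case False
    then have "0 \<le> k" by simp
    then show ?thesis
      by (induction k rule: int_ge_induct) (use that up in auto)
  qed (rule below)
qed

end

lemma cis_irrational:
  assumes "\<theta> \<notin> \<rat>"
  shows "circle_irrational (cis (2 * pi * \<theta>))"
proof
  fix n :: int assume "n \<noteq> 0"
  show "cis (2 * pi * \<theta>) powi n \<noteq> 1"
  proof
    assume "cis (2 * pi * \<theta>) powi n = 1"
    then have "cis (of_int n * (2 * pi * \<theta>)) = 1" by (simp add: cis_power_int)
    then have "cos (of_int n * (2 * pi * \<theta>)) = 1" by (simp add: complex_eq_iff)
    then obtain m :: int where "of_int n * (2 * pi * \<theta>) = of_int m * 2 * pi"
      using cos_one_2pi_int by blast
    then have "\<theta> = of_int m / of_int n" using \<open>n \<noteq> 0\<close> by (simp add: field_simps)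
    then show False using assms by simp
  qed
qed simp

section \<open>The GNS space of the irrational rotation algebra\<close>

locale rotation_gns = circle_irrational \<mu>
  for \<mu> :: complex +
  fixes u v :: "'a :: cstar_algebra"
    and \<tau> :: "'a \<Rightarrow> complex"
    and \<Lambda> :: "'a \<Rightarrow> 'h :: complex_hilbert_space"
    and \<pi> :: "'a \<Rightarrow> 'h \<Rightarrow>\<^sub>L 'h"
  assumes unitary_u: "unitary_element u" and unitary_v: "unitary_element v"
    and rotation: "v * u = \<mu> *\<^sub>C (u * v)"
    and generated: "generated_cstar_subalgebra {u, v} = UNIV"
    and trace: "tracial_state \<tau>"
    and gns: "gns_construction \<tau> \<Lambda> \<pi>"
begin

lemma trace_simps:
  "\<tau> (a + b) = \<tau> a + \<tau> b" "\<tau> (c *\<^sub>C a) = c * \<tau> a" "\<tau> 1 = 1"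
  using trace by (simp_all add: tracial_state_def)

lemma trace_commute: "\<tau> (a * b) = \<tau> (b * a)"
  using trace by (simp add: tracial_state_def)

lemma gns_add: "\<Lambda> (a + b) = \<Lambda> a + \<Lambda> b"
  and gns_scaleC: "\<Lambda> (c *\<^sub>C a) = c *\<^sub>C \<Lambda> a"
  and gns_cinner: "cinner (\<Lambda> a) (\<Lambda> b) = \<tau> (star b * a)"
  and gns_dense: "closure (range \<Lambda>) = UNIV"
  and gns_bounded: "\<pi> a \<in> bounded_operators"
  and gns_apply: "blinfun_apply (\<pi> a) (\<Lambda> b) = \<Lambda> (a * b)"
  using gns by (auto simp: gns_construction_def)

section \<open>Monomials in \<open>u\<close> and \<open>v\<close>, their products and their
  traces\<close>

definition monomial :: "int \<Rightarrow> int \<Rightarrow> 'a"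
  where "monomial n k = unitary_powi u n * unitary_powi v k"

lemma monomial_0_0 [simp]: "monomial 0 0 = 1"
  by (simp add: monomial_def)

lemma monomial_u: "monomial 1 0 = u" and monomial_v: "monomial 0 1 = v"
  by (simp_all add: monomial_def)

text \<open>The twisted commutation is used twice: first to move \<open>v\<close> past a power of
  \<open>u\<close>, then, with the inverse scalar, to move that power of \<open>u\<close> past a
  power of \<open>v\<close>.\<close>

lemma v_powi_u_powi:
  "unitary_powi v k * unitary_powi u n = (\<mu> powi (n * k)) *\<^sub>C (unitary_powi u n * unitary_powi v k)"
proof -
  have 1: "v * unitary_powi u n = (\<mu> powi n) *\<^sub>C (unitary_powi u n * v)"
    by (rule unitary_powi_twisted_commute[OF unitary_u rotation base_nonzero])
  then have "unitary_powi u n * v = inverse (\<mu> powi n) *\<^sub>C (v * unitary_powi u n)"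
    using base_nonzero by (simp add: scaleC_scaleC)
  from unitary_powi_twisted_commute[OF unitary_v this, of k]
  have "unitary_powi u n * unitary_powi v k
      = (inverse (\<mu> powi n) powi k) *\<^sub>C (unitary_powi v k * unitary_powi u n)"
    using base_nonzero by simp
  then show ?thesis
    using base_nonzero by (simp add: scaleC_scaleC power_int_mult power_int_inverse)
qed

lemma monomial_mult: "monomial n k * monomial n' k' = (\<mu> powi (n' * k)) *\<^sub>C monomial (n + n') (k + k')"
proof -
  have "monomial n k * monomial n' k'
      = unitary_powi u n * (unitary_powi v k * unitary_powi u n') * unitary_powi v k'"
    by (simp add: monomial_def mult.assoc)
  then show ?thesis
    by (simp add: v_powi_u_powi monomial_def scaleC_mult_left scaleC_mult_right mult.assoc
        unitary_powi_add[OF unitary_u] unitary_powi_add[OF unitary_v])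
qed

lemma star_monomial: "star (monomial n k) = (\<mu> powi (n * k)) *\<^sub>C monomial (- n) (- k)"
  by (simp add: monomial_def star_mult star_unitary_powi v_powi_u_powi)

text \<open>Conjugation by \<open>v\<close> or \<open>u\<close> leaves the trace unchanged but
  multiplies the monomial by a power of \<mu> whose exponent is \<open>n\<close> or \<open>k\<close>
  up to sign. As \<mu> is not a root of unity, only \<open>n = k = 0\<close> survives.\<close>

lemma trace_monomial: "\<tau> (monomial n k) = of_bool (n = 0 \<and> k = 0)"
proof -
  have "\<tau> (monomial n k) * (1 - \<mu> powi j) = 0" if "j = n \<or> j = k" for j
  proof -
    have "\<tau> (monomial n k * monomial 0 1 * monomial 0 (- 1)) = \<tau> (monomial 0 (- 1) * (monomial n k * monomial 0 1))"
      "\<tau> (monomial n k * monomial 1 0 * monomial (- 1) 0) = \<tau> (monomial (- 1) 0 * (monomial n k * monomial 1 0))"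
      by (rule trace_commute)+
    then have "\<tau> (monomial n k) = \<mu> powi (- n) * \<tau> (monomial n k)"
      "\<mu> powi k * \<mu> powi (- k) * \<tau> (monomial n k) = \<mu> powi k * \<tau> (monomial n k)"
      by (simp_all add: monomial_mult scaleC_mult_left scaleC_mult_right scaleC_scaleC trace_simps)
    then show ?thesis using that base_nonzero by (auto simp: power_int_minus field_simps)
  qed
  then show ?thesis using not_root_of_unity by (auto simp: trace_simps)
qed

lemma cinner_monomial:
  "cinner (\<Lambda> (monomial n k)) (\<Lambda> (monomial n' k')) = of_bool (n = n' \<and> k = k')"
  using base_nonzero
  by (cases "n = n' \<and> k = k'")
    (auto simp: gns_cinner star_monomial scaleC_mult_left monomial_mult trace_simps trace_monomial
      power_int_minus)

text \<open>For \<open>norm a < 1\<close>, write \<open>1 - star a * a\<close> as the square of a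
  self-adjoint \<open>d\<close>: the squared norms of \<open>\<Lambda> a\<close> and
  \<open>\<Lambda> d\<close> add up to 1. Scaling gives the rest. Continuity of \<Lambda> is what
  carries density in the algebra over to the Hilbert space.\<close>

lemma norm_gns_le: "norm (\<Lambda> a) \<le> norm a"
proof -
  have unit: "norm (\<Lambda> a) \<le> 1" if "norm a < 1" for a
  proof -
    have "norm (star a * a) < 1"
      using that by (simp add: cstar_identity power2_eq_square mult_strict_mono[of "norm a" 1 "norm a" 1, simplified])
    then obtain d where d: "star d = d" "d * d = 1 - star a * a"
      using self_adjoint_sqrt_exists[of "star a * a"] by (auto simp: star_mult star_star)
    have "\<tau> (star a * a) + \<tau> (star d * d) = \<tau> (star a * a + (1 - star a * a))"
      unfolding trace_simps(1) d ..
    then have "cinner (\<Lambda> a) (\<Lambda> a) + cinner (\<Lambda> d) (\<Lambda> d) = 1"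
      by (simp add: gns_cinner trace_simps(3))
    then have "complex_of_real ((norm (\<Lambda> a))\<^sup>2 + (norm (\<Lambda> d))\<^sup>2) = 1"
      by (simp add: cinner_self)
    then have "(norm (\<Lambda> a))\<^sup>2 + (norm (\<Lambda> d))\<^sup>2 = 1" by (simp only: of_real_eq_1_iff)
    then have "(norm (\<Lambda> a))\<^sup>2 \<le> 1" using zero_le_power2[of "norm (\<Lambda> d)"] by linarith
    then show ?thesis by (simp add: power_le_one_iff)
  qed
  show ?thesis
  proof (rule dense_ge)
    fix r assume r: "norm a < r"
    then have "0 < r" using norm_ge_zero[of a] by linarith
    have "norm (complex_of_real (1 / r) *\<^sub>C a) < 1"
      using r \<open>0 < r\<close> by (simp add: norm_scaleC norm_divide)
    then have "norm (complex_of_real (1 / r) *\<^sub>C \<Lambda> a) \<le> 1" using unit by (metis gns_scaleC)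
    then show "norm (\<Lambda> a) \<le> r" using \<open>0 < r\<close> by (simp add: norm_scaleC norm_divide field_simps)
  qed
qed

lemma gns_scaleR: "\<Lambda> (r *\<^sub>R a) = r *\<^sub>R \<Lambda> a"
  by (metis gns_scaleC scaleC_of_real)

lemma bounded_linear_gns: "bounded_linear \<Lambda>"
  by (rule bounded_linear_intro[where K = 1]) (auto simp: gns_add gns_scaleR norm_gns_le)

section \<open>Density of the Laurent polynomials in \<open>u\<close> and \<open>v\<close>\<close>

definition polynomials :: "'a set"
  where "polynomials = span (\<Union>n k. range (\<lambda>c. c *\<^sub>C monomial n k))"

lemma monomial_in_polynomials: "c *\<^sub>C monomial n k \<in> polynomials"
  unfolding polynomials_def by (rule span_base) blast

lemma subspace_polynomials: "subspace polynomials"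
  by (simp add: polynomials_def)

lemma polynomials_scaleC:
  assumes "a \<in> polynomials" shows "c *\<^sub>C a \<in> polynomials"
  using assms unfolding polynomials_def
proof (induction rule: span_induct)
  case base
  show ?case
    by (rule linear_subspace_vimage[unfolded vimage_def, OF bounded_linear.linear[OF bounded_linear_scaleC]]) simp
next
  case (step x)
  then show ?case
    using monomial_in_polynomials by (auto simp: polynomials_def scaleC_scaleC)
qed

lemma polynomials_star:
  assumes "a \<in> polynomials" shows "star a \<in> polynomials"
  using assms unfolding polynomials_def
proof (induction rule: span_induct)
  case base
  show ?case
    by (rule linear_subspace_vimage[unfolded vimage_def, OF bounded_linear.linear[OF bounded_linear_star]]) simp
next
  case (step x)
  then show ?case
    using monomial_in_polynomials by (auto simp: polynomials_def star_scaleC star_monomial scaleC_scaleC)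
qed

lemma polynomials_mult:
  assumes "a \<in> polynomials" "b \<in> polynomials" shows "a * b \<in> polynomials"
proof -
  have "c *\<^sub>C monomial n k * b \<in> polynomials" for c n k
    using assms(2) unfolding polynomials_def
  proof (induction rule: span_induct)
    case base
    show ?case
      by (rule linear_subspace_vimage[unfolded vimage_def,
            OF bounded_linear.linear[OF bounded_linear_mult_right]]) simp
  next
    case (step x)
    then show ?case
      using monomial_in_polynomials
      by (auto simp: polynomials_def scaleC_mult_left scaleC_mult_right monomial_mult scaleC_scaleC)
  qed
  note mono = this
  show ?thesis
    using assms(1) unfolding polynomials_def
  proof (induction rule: span_induct)
    case base
    show ?case
      by (rule linear_subspace_vimage[unfolded vimage_def,
            OF bounded_linear.linear[OF bounded_linear_mult_left]]) simp
  next
    case (step x)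
    then show ?case using mono by (auto simp: polynomials_def)
  qed
qed

lemma closure_polynomials_stable:
  assumes "bounded_linear f" "\<And>x. x \<in> polynomials \<Longrightarrow> f x \<in> closure polynomials"
    and "a \<in> closure polynomials"
  shows "f a \<in> closure polynomials"
  using image_closure_subset[of polynomials f "closure polynomials"] assms
    linear_continuous_on[OF assms(1)] by blast

text \<open>The closure is a C*-subalgebra containing the generators \<open>u\<close> and
  \<open>v\<close>.\<close>

lemma closure_polynomials: "closure polynomials = UNIV"
proof -
  have add: "a + b \<in> closure polynomials" if "a \<in> closure polynomials" "b \<in> closure polynomials" for a b
    using that subspace_add[OF subspace_polynomials] unfolding closure_sequential
    by (metis (no_types, lifting) tendsto_add)
  \<comment> \<open>Continuity is used in one factor at a time: the left factor is extended to the
    closure against a polynomial, then the right one.\<close>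
  have mult: "a * b \<in> closure polynomials" if "a \<in> closure polynomials" "b \<in> closure polynomials" for a b
  proof (rule closure_polynomials_stable[OF bounded_linear_mult_right _ that(2)])
    fix x assume x: "x \<in> polynomials"
    show "a * x \<in> closure polynomials"
      by (rule closure_polynomials_stable[OF bounded_linear_mult_left _ that(1)])
        (use polynomials_mult x closure_subset in blast)
  qed
  have "cstar_subalgebra (closure polynomials)"
    unfolding cstar_subalgebra_def
  proof (intro conjI ballI allI add mult)
    show "1 \<in> closure polynomials"
      using monomial_in_polynomials[of 1 0 0] closure_subset by auto
    show "star a \<in> closure polynomials" if "a \<in> closure polynomials" for a
      by (rule closure_polynomials_stable[OF bounded_linear_star _ that])
        (use polynomials_star closure_subset in blast)
    show "c *\<^sub>C a \<in> closure polynomials" if "a \<in> closure polynomials" for a c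
      by (rule closure_polynomials_stable[OF bounded_linear_scaleC _ that])
        (use polynomials_scaleC closure_subset in blast)
  qed simp
  moreover have "{u, v} \<subseteq> closure polynomials"
    using monomial_in_polynomials[of 1 1 0] monomial_in_polynomials[of 1 0 1] closure_subset
    by (auto simp: monomial_u monomial_v)
  ultimately have "generated_cstar_subalgebra {u, v} \<subseteq> closure polynomials"
    by (auto simp: generated_cstar_subalgebra_def)
  then show ?thesis by (auto simp: generated)
qed

sublocale total_orthonormal "\<lambda>(n, k). \<Lambda> (monomial n k)"
proof
  show "cinner (case i of (n, k) \<Rightarrow> \<Lambda> (monomial n k)) (case j of (n, k) \<Rightarrow> \<Lambda> (monomial n k))
      = of_bool (i = j)" for i j
    by (auto simp: cinner_monomial split: prod.splits)
  let ?B = "\<Union>i. range (\<lambda>c. c *\<^sub>C (case i of (n, k) \<Rightarrow> \<Lambda> (monomial n k)))"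
  have "?B = \<Lambda> ` (\<Union>n k. range (\<lambda>c. c *\<^sub>C monomial n k))"
    by (force simp: image_iff simp flip: gns_scaleC)
  then have "span ?B = \<Lambda> ` polynomials"
    by (simp add: polynomials_def linear_span_image bounded_linear.linear[OF bounded_linear_gns])
  \<comment> \<open>Continuity of \<Lambda> sends the dense polynomials to a set whose closure
    contains the dense range of \<Lambda>.\<close>
  moreover have "range \<Lambda> \<subseteq> closure (\<Lambda> ` polynomials)"
    using image_closure_subset[of polynomials \<Lambda> "closure (\<Lambda> ` polynomials)"]
      linear_continuous_on[OF bounded_linear_gns] closure_subset
    unfolding closure_polynomials by (metis closed_closure)
  then have "closure (range \<Lambda>) \<subseteq> closure (\<Lambda> ` polynomials)"
    by (rule closure_minimal) simp
  ultimately show "closure (span ?B) = UNIV" by (simp add: gns_dense top.extremum_unique)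
qed

section \<open>Matrix coefficients of operators in \<open>R\<close>\<close>

lemma gns_separating:
  assumes "\<And>b. cinner x (\<Lambda> b) = 0" shows "x = 0"
  using assms by (intro zero_if_coefficients_zero) (auto split: prod.splits)

text \<open>Right multiplications commute with \<open>R\<close>; expressed by matrix coefficients, this needs no
  construction of the right multiplication operators and is visibly closed in the strong topology.\<close>

definition right_modular :: "('h \<Rightarrow>\<^sub>L 'h) \<Rightarrow> bool"
  where "right_modular e \<longleftrightarrow> e \<in> bounded_operators \<and>
    (\<forall>a b. cinner (blinfun_apply e (\<Lambda> a)) (\<Lambda> b) = cinner (blinfun_apply e (\<Lambda> 1)) (\<Lambda> (b * star a)))"

lemma right_modular_id: "right_modular id_blinfun"
  by (auto simp: right_modular_def bounded_operators_def gns_cinner star_mult star_star trace_commute)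

lemma right_modular_diff:
  assumes "right_modular e" "right_modular f"
  shows "right_modular (e - f)"
  using assms
  by (auto simp: right_modular_def bounded_operators_def blinfun.diff_left cinner_diff_left scaleC_diff_right)

text \<open>For an operator \<open>\<pi> c\<close> both matrix coefficients equal
  \<open>\<tau> (star b * c * a)\<close>, by traciality. Matrix coefficients are strongly
  continuous, so the equation passes to the closure.\<close>

lemma right_modular_sot_closure:
  assumes "e \<in> sot_closure (range \<pi>)"
  shows "right_modular e"
proof -
  have "cinner (blinfun_apply e (\<Lambda> a)) (\<Lambda> b) - cinner (blinfun_apply e (\<Lambda> 1)) (\<Lambda> (b * star a)) = 0"
    for a b
  proof -
    let ?f = "\<lambda>T. cinner (blinfun_apply T (\<Lambda> a)) (\<Lambda> b) - cinner (blinfun_apply T (\<Lambda> 1)) (\<Lambda> (b * star a))"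
    let ?X = "subtopology strong_operator_topology (bounded_operators :: ('h \<Rightarrow>\<^sub>L 'h) set)"
    have eval: "continuous_map ?X euclidean (\<lambda>T. cinner (blinfun_apply T x) y)" for x y :: 'h
    proof -
      have "continuous_map ?X euclidean (\<lambda>T. blinfun_apply T x)"
        by (intro continuous_map_from_subtopology strong_operator_topology_continuous_evaluation)
      moreover have "continuous_map euclidean euclidean (\<lambda>z. cinner z y)"
        unfolding continuous_map_iff_continuous2
        by (rule linear_continuous_on[OF bounded_linear_cinner_left])
      ultimately have "continuous_map ?X euclidean ((\<lambda>z. cinner z y) \<circ> (\<lambda>T. blinfun_apply T x))"
        by (rule continuous_map_compose)
      then show ?thesis by (simp only: comp_def)
    qed
    have "continuous_map ?X euclidean ?f"
      by (rule continuous_map_diff[OF eval eval])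
    then have "closedin ?X {T \<in> topspace ?X. ?f T \<in> {0}}"
      by (rule closedin_continuous_map_preimage) simp
    moreover have "range \<pi> \<subseteq> {T \<in> topspace ?X. ?f T \<in> {0}}"
      using gns_bounded
      by (auto simp: strong_operator_topology_topspace gns_apply gns_cinner star_mult star_star
          mult.assoc trace_commute[of a])
    ultimately have "?X closure_of range \<pi> \<subseteq> {T \<in> topspace ?X. ?f T \<in> {0}}"
      by (rule closure_of_minimal[rotated])
    then show ?thesis using assms by (auto simp: sot_closure_def)
  qed
  moreover have "e \<in> bounded_operators"
    using assms closure_of_subset_topspace by (fastforce simp: sot_closure_def)
  ultimately show ?thesis by (auto simp: right_modular_def)
qed

text \<open>On vectors \<open>\<Lambda> c\<close> both sides are
  \<open>\<tau> (star b * a * c)\<close>; density of these vectors and continuity give the adjoint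
  relation everywhere.\<close>

lemma cinner_gns_apply: "cinner (blinfun_apply (\<pi> a) x) (\<Lambda> b) = cinner x (\<Lambda> (star a * b))"
proof -
  let ?S = "{x. cinner (blinfun_apply (\<pi> a) x) (\<Lambda> b) = cinner x (\<Lambda> (star a * b))}"
  have "closed ?S"
    by (intro closed_Collect_eq linear_continuous_on bounded_linear_cinner_left
        bounded_linear_compose[OF bounded_linear_cinner_left blinfun.bounded_linear_right])
  moreover have "range \<Lambda> \<subseteq> ?S"
    by (auto simp: gns_apply gns_cinner star_mult star_star mult.assoc)
  ultimately have "closure (range \<Lambda>) \<subseteq> ?S" by (rule closure_minimal[rotated])
  then show ?thesis by (auto simp: gns_dense)
qed

section \<open>Fourier coefficients of operators commuting with \<open>u + v\<close>\<close>

definition coefficient :: "('h \<Rightarrow>\<^sub>L 'h) \<Rightarrow> int \<Rightarrow> int \<Rightarrow> complex"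
  where "coefficient e n k = cinner (blinfun_apply e (\<Lambda> 1)) (\<Lambda> (monomial n k))"

lemma cnj_powi: "cnj (\<mu> powi n) = \<mu> powi (- n)"
proof -
  have "\<mu> * cnj \<mu> = 1" by (simp add: norm_base flip: complex_norm_square)
  then have "cnj \<mu> = inverse \<mu>" using base_nonzero by (simp add: field_simps)
  then show ?thesis by (simp add: power_int_inverse power_int_minus)
qed

text \<open>Right modularity moves the monomial to the other side and turns a matrix entry of
  \<open>e\<close> into a coefficient of \<open>e \<Lambda>(1)\<close>. Targets
  \<open>monomial N 0\<close> suffice, since the idempotent equation is compared only at
  \<open>k = 0\<close>.\<close>

lemma cinner_apply_monomial:
  assumes "right_modular e"
  shows "cinner (blinfun_apply e (\<Lambda> (monomial n k))) (\<Lambda> (monomial N 0))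
    = \<mu> powi (- (n * k)) * coefficient e (N - n) (- k)"
proof -
  have "cinner (blinfun_apply e (\<Lambda> (monomial n k))) (\<Lambda> (monomial N 0))
      = cinner (blinfun_apply e (\<Lambda> 1)) (\<Lambda> (monomial N 0 * star (monomial n k)))"
    using assms unfolding right_modular_def by blast
  then show ?thesis
    by (simp add: coefficient_def star_monomial scaleC_mult_right monomial_mult gns_scaleC
        cinner_scaleC_right cnj_powi del: complex_cnj_power_int)
qed

context
  fixes e :: "'h \<Rightarrow>\<^sub>L 'h"
  assumes modular: "right_modular e"
    and commute: "e o\<^sub>L \<pi> (u + v) = \<pi> (u + v) o\<^sub>L e"
begin

text \<open>Pair both sides of the commutation, applied to \<open>\<Lambda> 1\<close>, with a
  monomial. Right modularity multiplies it by \<open>star u\<close> and \<open>star v\<close> on the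
  right, the adjoint of \<open>\<pi> (u + v)\<close> on the left; the two differ only by powers of
  \<mu>.\<close>

lemma coefficient_recurrence:
  "(1 - \<mu> powi k) * coefficient e (n - 1) k = (1 - \<mu> powi n) * coefficient e n (k - 1)"
proof -
  let ?X = "\<lambda>b. cinner (blinfun_apply e (\<Lambda> 1)) (\<Lambda> b)" and ?m = "monomial n k"
  have star: "star u = monomial (- 1) 0" "star v = monomial 0 (- 1)"
    by (simp_all add: monomial_def)
  have "blinfun_apply (e o\<^sub>L \<pi> (u + v)) (\<Lambda> 1) = blinfun_apply (\<pi> (u + v) o\<^sub>L e) (\<Lambda> 1)"
    by (simp only: commute)
  then have "blinfun_apply e (\<Lambda> u) + blinfun_apply e (\<Lambda> v)
      = blinfun_apply (\<pi> (u + v)) (blinfun_apply e (\<Lambda> 1))"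
    by (simp add: gns_apply gns_add blinfun.add_right)
  then have "cinner (blinfun_apply e (\<Lambda> u)) (\<Lambda> ?m) + cinner (blinfun_apply e (\<Lambda> v)) (\<Lambda> ?m)
      = cinner (blinfun_apply (\<pi> (u + v)) (blinfun_apply e (\<Lambda> 1))) (\<Lambda> ?m)"
    by (simp flip: cinner_add_left)
  moreover have "cinner (blinfun_apply e (\<Lambda> a)) (\<Lambda> ?m) = ?X (?m * star a)" for a
    using modular unfolding right_modular_def by blast
  ultimately have "?X (?m * star u) + ?X (?m * star v) = ?X (star u * ?m) + ?X (star v * ?m)"
    by (simp add: cinner_gns_apply star_add distrib_right gns_add cinner_add_right)
  then have "\<mu> powi k * coefficient e (n - 1) k + coefficient e n (k - 1)
      = coefficient e (n - 1) k + \<mu> powi n * coefficient e n (k - 1)"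
    by (simp add: star monomial_mult gns_scaleC cinner_scaleC_right cnj_powi coefficient_def
        del: complex_cnj_power_int)
  then show ?thesis by (simp add: algebra_simps)
qed

lemma antidiagonal_recurrence:
  "(1 - \<mu> powi k) * coefficient e (N - k) k
    = (1 - \<mu> powi (N + 1 - k)) * coefficient e (N - (k - 1)) (k - 1)"
  using coefficient_recurrence[of k "N + 1 - k"] by (simp add: algebra_simps)

lemma antidiagonal_decay:
  assumes "0 < \<epsilon>" shows "finite {k. \<epsilon> \<le> cmod (coefficient e (N - k) k)}"
proof -
  have "inj (\<lambda>k. (N - k, k))" by (rule injI) simp
  from finite_vimageI[OF finite_large_coefficients[OF assms] this]
  show ?thesis by (simp add: coefficient_def vimage_def)
qed

lemma coefficient_negative_degree:
  assumes "n + k < 0" shows "coefficient e n k = 0"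
proof -
  \<comment> \<open>\<open>negative_degree_zero\<close> concerns the degree \<open>- m - 1\<close>,
    whence \<open>m = - 1 - N\<close>.\<close>
  define N m where "N = n + k" and "m = nat (- 1 - N)"
  have m: "- int m = N + 1" using assms by (simp add: m_def N_def)
  have "coefficient e (N - k) k = 0"
    by (rule negative_degree_zero[of "\<lambda>k. coefficient e (N - k) k" m])
      (simp_all only: m antidiagonal_recurrence antidiagonal_decay)
  then show ?thesis by (simp add: N_def)
qed

lemma coefficient_support:
  assumes "coefficient e n k \<noteq> 0" shows "0 \<le> n" "0 \<le> k"
proof -
  define N where "N = n + k"
  have nz: "coefficient e (N - k) k \<noteq> 0" using assms by (simp add: N_def)
  have N: "0 \<le> N" using coefficient_negative_degree[of n k] assms by (force simp: N_def)
  show "0 \<le> k"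
    using nonneg_degree_below[of "\<lambda>k. coefficient e (N - k) k" N k, OF antidiagonal_recurrence N] nz
    by force
  show "0 \<le> n"
    using nonneg_degree_above[of "\<lambda>k. coefficient e (N - k) k" N k, OF antidiagonal_recurrence N] nz
    by (force simp: N_def)
qed

text \<open>The entry at \<open>k = 0\<close> determines its whole antidiagonal, so
  \<open>e \<Lambda>(1)\<close> vanishes; by right modularity, so do all matrix coefficients of
  \<open>e\<close> on the range of \<Lambda>.\<close>

lemma zero_if_first_column_zero:
  assumes "\<And>n. 0 \<le> n \<Longrightarrow> coefficient e n 0 = 0"
  shows "e = 0"
proof -
  have "coefficient e n k = 0" for n k
  proof (cases "n + k < 0")
    case False
    have "coefficient e (n + k - k) k = 0"
      by (rule nonneg_degree_zero[of "\<lambda>j. coefficient e (n + k - j) j" "n + k"])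
        (use antidiagonal_recurrence assms False in auto)
    then show ?thesis by simp
  qed (rule coefficient_negative_degree)
  then have "blinfun_apply e (\<Lambda> 1) = 0"
    by (intro zero_if_coefficients_zero) (auto simp: coefficient_def)
  then have "cinner (blinfun_apply e (\<Lambda> a)) (\<Lambda> b) = 0" for a b
    using modular by (simp add: right_modular_def)
  then have zero: "blinfun_apply e (\<Lambda> a) = 0" for a by (rule gns_separating)
  have "closure (range \<Lambda>) \<subseteq> {x. blinfun_apply e x = 0}"
    by (rule closure_minimal)
      (auto simp: zero intro!: closed_Collect_eq linear_continuous_on blinfun.bounded_linear_right)
  then show ?thesis by (intro blinfun_eqI) (auto simp: gns_dense)
qed

section \<open>The idempotent equation for the coefficients\<close>

context
  assumes idempotent: "e o\<^sub>L e = e"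
begin

text \<open>Formally \<open>e = (\<Sum>n. c n (u + v) ^ n)\<close> with \<open>c n = coefficient e n 0\<close>, so \<open>e o\<^sub>L e = e\<close> says that
  \<open>c\<close> is an idempotent for the convolution product.\<close>

lemma cinner_apply_apply: "cinner (blinfun_apply e (blinfun_apply e (\<Lambda> 1))) y
    = cinner (blinfun_apply e (\<Lambda> 1)) y"
  using arg_cong[OF idempotent, of "\<lambda>f. blinfun_apply f (\<Lambda> 1)"] by simp

lemma functional_linear:
  "bounded_linear (\<lambda>x. cinner (blinfun_apply e x) y)"
  "cinner (blinfun_apply e (c *\<^sub>C x)) y = c * cinner (blinfun_apply e x) y"
  using modular bounded_linear_compose[OF bounded_linear_cinner_left blinfun.bounded_linear_right]
  by (auto simp: right_modular_def bounded_operators_def cinner_scaleC_left)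

text \<open>Up to powers of \<mu>, the constant coefficient of \<open>e o\<^sub>L e\<close> collects
  the products of the coefficients at \<open>(n, k)\<close> and \<open>(- n, - k)\<close>. Since the
  support lies in the quadrant \<open>0 \<le> n\<close>, \<open>0 \<le> k\<close>, only
  \<open>n = k = 0\<close> contributes.\<close>

lemma constant_coefficient_idempotent:
  "coefficient e 0 0 * coefficient e 0 0 = coefficient e 0 0"
proof -
  let ?c = "coefficient e 0 0"
  let ?\<phi> = "\<lambda>x. cinner (blinfun_apply e x) (\<Lambda> (monomial 0 0))"
  \<comment> \<open>With the constant term removed, the remainder falls under
    \<open>functional_vanishes\<close>.\<close>
  have "?\<phi> (blinfun_apply e (\<Lambda> 1) - ?c *\<^sub>C \<Lambda> (monomial 0 0)) = 0"
  proof (rule functional_vanishes[OF functional_linear])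
    fix i :: "int \<times> int"
    obtain n k where i: "i = (n, k)" by fastforce
    have "cinner (blinfun_apply e (\<Lambda> 1) - ?c *\<^sub>C \<Lambda> (monomial 0 0)) (\<Lambda> (monomial n k))
        = coefficient e n k - ?c * of_bool (0 = n \<and> 0 = k)"
      unfolding cinner_diff_left cinner_scaleC_left cinner_monomial coefficient_def ..
    moreover have "?\<phi> (\<Lambda> (monomial n k)) = \<mu> powi (- (n * k)) * coefficient e (0 - n) (- k)"
      by (rule cinner_apply_monomial[OF modular])
    ultimately show "cinner (blinfun_apply e (\<Lambda> 1) - ?c *\<^sub>C \<Lambda> (monomial 0 0))
          (case i of (n, k) \<Rightarrow> \<Lambda> (monomial n k)) = 0
        \<or> ?\<phi> (case i of (n, k) \<Rightarrow> \<Lambda> (monomial n k)) = 0"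
      using coefficient_support[of n k] coefficient_support[of "- n" "- k"]
      by (cases "n = 0 \<and> k = 0") (force simp: i)+
  qed
  then have "?\<phi> (blinfun_apply e (\<Lambda> 1)) = ?c * ?\<phi> (\<Lambda> (monomial 0 0))"
    by (simp add: blinfun.diff_right cinner_diff_left functional_linear)
  then show ?thesis
    by (simp add: cinner_apply_apply coefficient_def)
qed

text \<open>A power series without constant term that equals its own square is zero: by induction on
  the degree, every product in the convolution has a vanishing factor.\<close>

lemma zero_if_constant_coefficient_zero:
  assumes zero: "coefficient e 0 0 = 0"
  shows "e = 0"
proof (rule zero_if_first_column_zero)
  fix N :: int assume "0 \<le> N"
  then show "coefficient e N 0 = 0"
  proof (induction "nat N" arbitrary: N rule: less_induct)
    case less
    have IH: "coefficient e n 0 = 0" if "0 \<le> n" "n < N" for n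
      using less that by simp
    have "cinner (blinfun_apply e (blinfun_apply e (\<Lambda> 1))) (\<Lambda> (monomial N 0)) = 0"
    proof (rule functional_vanishes[OF functional_linear])
      fix i :: "int \<times> int"
      obtain n k where i: "i = (n, k)" by fastforce
      \<comment> \<open>By the support, two nonzero factors need \<open>k = 0\<close> and
        \<open>0 \<le> n \<le> N\<close>. For \<open>n < N\<close> the first factor is zero by
        induction; for \<open>n = N\<close> the second is the constant coefficient.\<close>
      have "coefficient e n k = 0 \<or> coefficient e (N - n) (- k) = 0"
        using coefficient_support[of n k] coefficient_support[of "N - n" "- k"] IH[of n] zero
        by (cases "n = N"; cases "k = 0") force+
      then show "cinner (blinfun_apply e (\<Lambda> 1)) (case i of (n, k) \<Rightarrow> \<Lambda> (monomial n k)) = 0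
          \<or> cinner (blinfun_apply e (case i of (n, k) \<Rightarrow> \<Lambda> (monomial n k))) (\<Lambda> (monomial N 0)) = 0"
        using cinner_apply_monomial[OF modular, of n k N] by (auto simp: i coefficient_def)
    qed
    then show ?case by (simp add: cinner_apply_apply coefficient_def)
  qed
qed

end

end

text \<open>The constant coefficient is 0 or 1. In the second case \<open>id_blinfun - e\<close> is
  again a right modular idempotent commuting with \<open>\<pi> (u + v)\<close>, now with constant
  coefficient 0.\<close>

lemma idempotent_trivial:
  assumes modular: "right_modular e"
    and commute: "e o\<^sub>L \<pi> (u + v) = \<pi> (u + v) o\<^sub>L e"
    and idempotent: "e o\<^sub>L e = e"
  shows "e = 0 \<or> e = id_blinfun"
proof (cases "coefficient e 0 0 = 0")
  case True
  then show ?thesis using zero_if_constant_coefficient_zero[OF assms] by blast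
next
  case False
  then have one: "coefficient e 0 0 = 1" using constant_coefficient_idempotent[OF assms] by simp
  let ?f = "id_blinfun - e"
  have "blinfun_apply e (blinfun_apply e x) = blinfun_apply e x" for x
    using arg_cong[OF idempotent, of "\<lambda>f. blinfun_apply f x"] by simp
  then have idem: "?f o\<^sub>L ?f = ?f"
    by (intro blinfun_eqI) (simp add: blinfun.diff_left blinfun.diff_right)
  have "blinfun_apply e (blinfun_apply (\<pi> (u + v)) x) = blinfun_apply (\<pi> (u + v)) (blinfun_apply e x)" for x
    using arg_cong[OF commute, of "\<lambda>f. blinfun_apply f x"] by simp
  then have comm: "?f o\<^sub>L \<pi> (u + v) = \<pi> (u + v) o\<^sub>L ?f"
    by (intro blinfun_eqI) (simp add: blinfun.diff_left blinfun.diff_right)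
  have "coefficient ?f 0 0 = 0"
    using one by (simp add: coefficient_def blinfun.diff_left cinner_diff_left gns_cinner trace_simps(3))
  from zero_if_constant_coefficient_zero[OF right_modular_diff[OF right_modular_id modular] comm idem this]
  show ?thesis by simp
qed

end

theorem theorem10p2:
  fixes \<theta> :: real
    and u v :: "'a :: cstar_algebra"
    and \<tau> :: "'a \<Rightarrow> complex"
    and \<Lambda> :: "'a \<Rightarrow> 'h :: complex_hilbert_space"
    and \<pi> :: "'a \<Rightarrow> 'h \<Rightarrow>\<^sub>L 'h"
    and R :: "('h \<Rightarrow>\<^sub>L 'h) set"
  assumes "0 < \<theta>" "\<theta> < 1" "\<theta> \<notin> \<rat>"
    and "universal_rotation_algebra \<theta> u v"
    and "tracial_state \<tau>"
    and "gns_construction \<tau> \<Lambda> \<pi>"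
    and "R = sot_closure (range \<pi>)"
  shows "strongly_irreducible_relative (\<pi> (u + v)) R"
proof -
  interpret circle_irrational "cis (2 * pi * \<theta>)"
    using \<open>\<theta> \<notin> \<rat>\<close> by (rule cis_irrational)
  interpret rotation_gns "cis (2 * pi * \<theta>)" u v \<tau> \<Lambda> \<pi>
    using assms(4-6) by unfold_locales (auto simp: universal_rotation_algebra_def)
  show ?thesis
    unfolding strongly_irreducible_relative_def commutant_def \<open>R = _\<close>
    using idempotent_trivial right_modular_sot_closure by blast
qed

end
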